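(* Let $q\geq 5$ be odd. For all $0<\alpha\leq\beta\leq 1$, \[ \operatorname*{w^*\text{-}lim}_{n\to\infty}\Big(\log(n)\cdot m\big|_{F_q^{-n}([\alpha,\beta])}\Big)=\log(\beta/\alpha)\, m , \] i.e. for every continuous $f\colon[0,1]\to\mathbb{R}$ we have $\log(n)\int_{F_q^{-n}([\alpha,\beta])} f\,dm \to \log(\beta/\alpha)\int_{[0,1]} f\,dm$ as $n\to\infty$.
   Context: Setup. Let $q\geq 3$ be odd and $\lambda=\lambda_q=2\cos(\pi/q)$. Elements of $\mathrm{PGL}_2(\mathbb{R})$ are written as matrices $\begin{bmatrix}a&b\\c&d\end{bmatrix}$ (a matrix and its nonzero scalar multiples represent the same element); they act on $\mathbb{R}\cup\{\infty\}$ by $x\mapsto (ax+b)/(cx+d)$, written $g.x$. The Hecke triangle group $\Gamma_q\subset\mathrm{PSL}_2(\mathbb{R})$ is generated by $T=\begin{bmatrix}1&\lambda\\0&1\end{bmatrix}$ and $S=\begin{bmatrix}0&1\\-1&0\end{bmatrix}$. Put $s(x)=\sin(x\pi/q)/\sin(\pi/q)$, $g_k=\begin{bmatrix}s(k)&-s(k+1)\\-s(k-1)&s(k)\end{bmatrix}\in\Gamma_q$ for $k\in\mathbb{Z}$, and $Q=\begin{bmatrix}0&1\\1&0\end{bmatrix}$. Let $K=\{(q+1)/2,\dots,q-1\}$. The generalized Farey map $F_q\colon[0,1]\to[0,1]$ is defined, for $k\in K$, by $F_q(x)=g_k.x$ for $x\in[g_k^{-1}.0,g_k^{-1}.1]$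 and $F_q(x)=Qg_k.x$ for $x\in[(Qg_k)^{-1}.1,(Qg_k)^{-1}.0]$ (these intervals cover $[0,1]$, overlap only at endpoints, and the definitions agree there). $m$ denotes Lebesgue measure on $[0,1]$ and $m|_B$ its restriction to a Borel set $B$. *)

theory Defs
  imports "HOL-Analysis.Analysis"
begin

text \<open>Elements of PGL_2(R) represented by matrices (a,b,c,d) = [a b; c d].\<close>
type_synonym mat2 = "real \<times> real \<times> real \<times> real"

definition mob :: "mat2 \<Rightarrow> real \<Rightarrow> real" where
  "mob M x = (case M of (a,b,c,d) \<Rightarrow> (a*x + b) / (c*x + d))"

definition mmul :: "mat2 \<Rightarrow> mat2 \<Rightarrow> mat2" where
  "mmul M N = (case M of (a,b,c,d) \<Rightarrow> case N of (e,f,g,h) \<Rightarrow>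
     (a*e + b*g, a*f + b*h, c*e + d*g, c*f + d*h))"

text \<open>Inverse in PGL_2 (adjugate, a scalar multiple of the matrix inverse).\<close>
definition minv :: "mat2 \<Rightarrow> mat2" where
  "minv M = (case M of (a,b,c,d) \<Rightarrow> (d, -b, -c, a))"

definition hs :: "nat \<Rightarrow> real \<Rightarrow> real" where
  "hs q x = sin (x * pi / real q) / sin (pi / real q)"

definition hg :: "nat \<Rightarrow> int \<Rightarrow> mat2" where
  "hg q k = (hs q (real_of_int k), - hs q (real_of_int k + 1),
             - hs q (real_of_int k - 1), hs q (real_of_int k))"

definition Qm :: mat2 where "Qm = (0, 1, 1, 0)"

definition Kset :: "nat \<Rightarrow> int set" where
  "Kset q = {(int q + 1) div 2 .. int q - 1}"

definition farey :: "nat \<Rightarrow> real \<Rightarrow> real" where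
  "farey q x = (SOME y. \<exists>k\<in>Kset q.
      (x \<in> {mob (minv (hg q k)) 0 .. mob (minv (hg q k)) 1} \<and> y = mob (hg q k) x) \<or>
      (x \<in> {mob (minv (mmul Qm (hg q k))) 1 .. mob (minv (mmul Qm (hg q k))) 0}
          \<and> y = mob (mmul Qm (hg q k)) x))"

definition farey_preimage :: "nat \<Rightarrow> nat \<Rightarrow> real set \<Rightarrow> real set" where
  "farey_preimage q n A = {x \<in> {0..1}. (farey q ^^ n) x \<in> A}"

end

theory Submission
  imports Defs "HOL-Real_Asymp.Real_Asymp"
begin

text \<open>
  The inverse branches of \<open>F\<close> are \<open>y \<mapsto> b (y + a) / (y + b)\<close> and \<open>y \<mapsto> b (1 + a y) / (1 + b y)\<close>,
  where \<open>a < b\<close> run through consecutive points of the partition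
  \<open>r i = sin (i pi / q) / sin ((i + 1) pi / q)\<close> of the unit interval. The measure with density \<open>1 / x\<close>
  is invariant; relative to it the transfer operator is an averaging operator \<open>T\<close>.
  The key point is that \<open>T\<close> preserves the class of increasing concave functions. For
  \<open>v n = T ^^ n (x f(x))\<close> in this class, \<open>u n = v n 1\<close> is the maximum of \<open>v n\<close>, hence decreases in \<open>n\<close>.
  Iterating the indifferent branch \<open>y \<mapsto> y / (1 + l y)\<close> at \<open>0\<close> shows that \<open>v n x\<close> is about \<open>u n\<close>
  for \<open>x\<close> much larger than \<open>1 / n\<close> and negligible below, so that conservation of the mass
  \<open>\<integral> v n x / x dx = \<integral> f\<close> forces \<open>u n * ln n \<longlonglongrightarrow> \<integral> f\<close>, without any Tauberian theorem. Finally \<open>v n\<close> is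
  asymptotically constant on compact subsets of \<open>(0, 1]\<close>, and every polynomial is a difference of two
  functions \<open>f\<close> for which \<open>x f(x)\<close> is increasing and concave.
\<close>

section \<open>Inverse branches\<close>

text \<open>Monotonicity alone does not survive \<open>T\<close>. The branches \<open>brB\<close>
  reverse orientation, so the indicator of the points to the right of \<open>brB a b 1\<close>, for
  the last cell, is sent to a function that vanishes at 1 and is positive on the rest of the open
  interval. Concavity repairs this. The branches come in pairs over one partition cell, with the
  point of \<open>brA\<close> on the left, and a decreasing derivative lets the term of
  \<open>brA\<close> dominate that of \<open>brB\<close>; second derivatives are controlled in order
  to have this input again for the next iterate. The differentiated weights are handled separately:
  \<open>wA\<close> and \<open>wB\<close> are differences of one function at consecutive partition
  points, so summation by parts applies, and its boundary terms match because the last point is 1.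
  The logarithm is the mass of \<open>1 / x\<close> on \<open>{1 / n..1}\<close>, where
  \<open>1 / n\<close> is the scale to which \<open>n\<close> steps of the indifferent branch
  contract the unit interval.\<close>

definition brA :: "real \<Rightarrow> real \<Rightarrow> real \<Rightarrow> real" where
  "brA a b y = b * (y + a) / (y + b)"

definition brB :: "real \<Rightarrow> real \<Rightarrow> real \<Rightarrow> real" where
  "brB a b y = b * (1 + a * y) / (1 + b * y)"

definition dA :: "real \<Rightarrow> real \<Rightarrow> real \<Rightarrow> real" where
  "dA a b y = b * (b - a) / (y + b)^2"

text \<open>\<open>brB\<close> decreases, so \<open>dB\<close> is the absolute value of its
  derivative.\<close>

definition dB :: "real \<Rightarrow> real \<Rightarrow> real \<Rightarrow> real" where
  "dB a b y = b * (b - a) / (1 + b * y)^2"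

text \<open>Passing from Lebesgue measure to the density \<open>1 / x\<close> turns the Jacobian
  \<open>dA\<close> into \<open>y * dA a b y / brA a b y\<close>. This is its partial fraction form,
  a difference of one function at the two ends of the cell; likewise for \<open>wB\<close>.\<close>

definition wA :: "real \<Rightarrow> real \<Rightarrow> real \<Rightarrow> real" where
  "wA a b y = b / (y + b) - a / (y + a)"

definition wB :: "real \<Rightarrow> real \<Rightarrow> real \<Rightarrow> real" where
  "wB a b y = 1 / (1 + a * y) - 1 / (1 + b * y)"

section \<open>Derivatives of the branches, Jacobians and weights\<close>

lemma inverse_affine_deriv:
  assumes "p + s * y \<noteq> (0::real)"
  shows "((\<lambda>y. k / (p + s * y)) has_real_derivative - (k * s / (p + s * y)^2)) (at y)"
  using assms by (auto intro!: derivative_eq_intros simp: power2_eq_square)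

lemma inverse_affine_square_deriv:
  assumes "p + s * y \<noteq> (0::real)"
  shows "((\<lambda>y. k / (p + s * y)^2) has_real_derivative - (2 * k * s / (p + s * y)^3)) (at y)"
proof -
  have "((\<lambda>y. k * inverse (p + s * y)^2) has_real_derivative
     k * (2 * inverse (p + s * y) * (- (inverse (p + s * y) * s * inverse (p + s * y))))) (at y)"
    using assms by (auto intro!: derivative_eq_intros)
  then show ?thesis
    by (simp add: field_simps power2_eq_square power3_eq_cube)
qed

lemma brA_deriv:
  assumes "y + b \<noteq> 0"
  shows "(brA a b has_real_derivative dA a b y) (at y)"
proof -
  have "((\<lambda>y. b * (y + a) / (y + b)) has_real_derivative
      (b * (y + b) - b * (y + a)) / ((y + b) * (y + b))) (at y)"
    using assms by (auto intro!: derivative_eq_intros)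
  moreover have "(b * (y + b) - b * (y + a)) / ((y + b) * (y + b)) = dA a b y"
    unfolding dA_def by (simp add: power2_eq_square algebra_simps)
  ultimately show ?thesis unfolding brA_def[abs_def] by simp
qed

lemma brB_deriv:
  assumes "1 + b * y \<noteq> 0"
  shows "(brB a b has_real_derivative - dB a b y) (at y)"
proof -
  have "((\<lambda>y. b * (1 + a * y) / (1 + b * y)) has_real_derivative
      (b * a * (1 + b * y) - b * (1 + a * y) * b) / ((1 + b * y) * (1 + b * y))) (at y)"
    using assms by (auto intro!: derivative_eq_intros)
  moreover have "(b * a * (1 + b * y) - b * (1 + a * y) * b) / ((1 + b * y) * (1 + b * y)) = - dB a b y"
    unfolding dB_def minus_divide_left by (simp add: power2_eq_square algebra_simps)
  ultimately show ?thesis unfolding brB_def[abs_def] by simp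
qed

lemma dA_deriv:
  assumes "y + b \<noteq> 0"
  shows "(dA a b has_real_derivative - (2 * dA a b y / (y + b))) (at y)"
  using inverse_affine_square_deriv[of b 1 y "b * (b - a)"] assms
  unfolding dA_def[abs_def] by (simp add: add.commute power2_eq_square power3_eq_cube mult.assoc)

lemma dB_deriv:
  assumes "1 + b * y \<noteq> 0"
  shows "(dB a b has_real_derivative - (2 * b * dB a b y / (1 + b * y))) (at y)"
  using inverse_affine_square_deriv[of 1 b y "b * (b - a)"] assms
  unfolding dB_def[abs_def] by (simp add: power2_eq_square power3_eq_cube mult_ac)

lemma wA_deriv:
  assumes "y + a \<noteq> 0" "y + b \<noteq> 0"
  shows "(wA a b has_real_derivative (a / (y + a)^2 - b / (y + b)^2)) (at y)"
  using DERIV_diff[OF inverse_affine_deriv[of b 1 y b] inverse_affine_deriv[of a 1 y a]] assms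
  unfolding wA_def[abs_def] by (simp add: add.commute)

lemma wA_deriv2:
  assumes "y + a \<noteq> 0" "y + b \<noteq> 0"
  shows "((\<lambda>y. a / (y + a)^2 - b / (y + b)^2) has_real_derivative
    (2 * b / (y + b)^3 - 2 * a / (y + a)^3)) (at y)"
  using DERIV_diff[OF inverse_affine_square_deriv[of a 1 y a] inverse_affine_square_deriv[of b 1 y b]] assms
  by (simp add: add.commute)

lemma wB_deriv:
  assumes "1 + a * y \<noteq> 0" "1 + b * y \<noteq> 0"
  shows "(wB a b has_real_derivative (b / (1 + b * y)^2 - a / (1 + a * y)^2)) (at y)"
  using DERIV_diff[OF inverse_affine_deriv[of 1 a y 1] inverse_affine_deriv[of 1 b y 1]] assms
  unfolding wB_def[abs_def] by (simp add: add.commute)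

lemma wB_deriv2:
  assumes "1 + a * y \<noteq> 0" "1 + b * y \<noteq> 0"
  shows "((\<lambda>y. b / (1 + b * y)^2 - a / (1 + a * y)^2) has_real_derivative
    (2 * a^2 / (1 + a * y)^3 - 2 * b^2 / (1 + b * y)^3)) (at y)"
  using DERIV_diff[OF inverse_affine_square_deriv[of 1 b y b] inverse_affine_square_deriv[of 1 a y a]] assms
  by (simp add: add.commute power2_eq_square mult_ac)

text \<open>Summation by parts moves the differences from the coefficients to \<open>G\<close> and
  \<open>H\<close>. Interior terms are nonnegative since both \<open>e\<close> and the increments of
  \<open>H\<close> are dominated; the lower end contributes nothing, and at the upper end
  \<open>c N = e N\<close> leaves a multiple of \<open>H - G\<close>. The values of a concave
  function at the \<open>brA\<close> and \<open>brB\<close> points will serve as \<open>G\<close>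
  and \<open>H\<close>.\<close>

lemma abel_two_sequences_nonneg:
  fixes c e G H :: "nat \<Rightarrow> real"
  assumes "0 < N" "c 0 = 0" "e 0 = 0" "c N = e N"
    and ce: "\<And>i. i \<le> N \<Longrightarrow> 0 \<le> e i \<and> e i \<le> c i"
    and inc: "\<And>i. Suc i < N \<Longrightarrow> 0 \<le> H (Suc i) - H i \<and> H (Suc i) - H i \<le> G (Suc i) - G i"
    and GH: "\<And>i. i < N \<Longrightarrow> G i \<le> H i"
  shows "0 \<le> (\<Sum>i<N. (c i - c (Suc i)) * G i + (e (Suc i) - e i) * H i)"
proof -
  obtain M where M: "N = Suc M" using assms(1) by (cases N) auto
  have abel: "(\<Sum>i<Suc n. (c i - c (Suc i)) * G i + (e (Suc i) - e i) * H i)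
    = (\<Sum>i<n. c (Suc i) * (G (Suc i) - G i) - e (Suc i) * (H (Suc i) - H i))
      - c (Suc n) * G n + e (Suc n) * H n" for n
    by (induction n) (auto simp: assms(2,3) algebra_simps)
  have "0 \<le> (\<Sum>i<M. c (Suc i) * (G (Suc i) - G i) - e (Suc i) * (H (Suc i) - H i))"
  proof (rule sum_nonneg)
    fix i assume "i \<in> {..<M}"
    then have "0 \<le> e (Suc i) \<and> e (Suc i) \<le> c (Suc i)"
      "0 \<le> H (Suc i) - H i \<and> H (Suc i) - H i \<le> G (Suc i) - G i"
      using ce[of "Suc i"] inc[of i] M by auto
    then have "e (Suc i) * (H (Suc i) - H i) \<le> c (Suc i) * (G (Suc i) - G i)"
      by (intro mult_mono) auto
    then show "0 \<le> c (Suc i) * (G (Suc i) - G i) - e (Suc i) * (H (Suc i) - H i)" by simp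
  qed
  moreover have "c N * G M \<le> e N * H M"
    using ce[of N] GH[of M] assms(4) M by (simp add: mult_left_mono)
  ultimately show ?thesis unfolding M abel using M by simp
qed

text \<open>Concavity is expressed by a second derivative, not by chords, because \<open>T g\<close>
  is differentiated term by term. The derivatives are two-sided even at 1, while nothing is required
  at the indifferent fixed point 0.\<close>

definition incr_concave :: "(real \<Rightarrow> real) \<Rightarrow> bool" where
  "incr_concave g \<longleftrightarrow> (\<exists>g1 g2. \<forall>x\<in>{0<..1}. (g has_real_derivative g1 x) (at x)
     \<and> (g1 has_real_derivative g2 x) (at x) \<and> 0 \<le> g1 x \<and> g2 x \<le> 0)"

section \<open>Increments of increasing concave functions, ranges of the branches\<close>

lemma deriv_nonneg_mono:
  assumes "\<And>x. x \<in> {0<..1} \<Longrightarrow> (g has_real_derivative g1 x) (at x)"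
    and "\<And>x. x \<in> {0<..1} \<Longrightarrow> 0 \<le> g1 x" and "0 < s" "s \<le> t" "t \<le> 1"
  shows "g s \<le> (g t :: real)"
proof (rule DERIV_nonneg_imp_nondecreasing[OF assms(4)])
  fix x assume "s \<le> x" "x \<le> t"
  then have "x \<in> {0<..1}" using assms(3,5) by simp
  then show "\<exists>z. (g has_real_derivative z) (at x) \<and> 0 \<le> z" using assms(1,2) by blast
qed

lemma incr_concave_mono:
  assumes "incr_concave g" "0 < s" "s \<le> t" "t \<le> 1"
  shows "g s \<le> g t"
proof -
  obtain g1 g2 where "\<forall>x\<in>{0<..1}. (g has_real_derivative g1 x) (at x)
     \<and> (g1 has_real_derivative g2 x) (at x) \<and> 0 \<le> g1 x \<and> g2 x \<le> 0"
    using assms(1) incr_concave_def by auto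
  then show ?thesis using deriv_nonneg_mono[of g g1] assms by auto
qed

text \<open>By the mean value theorem an increment is a slope times a length, and the interval
  further to the right has both the smaller slope and the smaller length.\<close>

lemma concave_increments:
  assumes d: "\<And>x. x \<in> {0<..1} \<Longrightarrow> (g has_real_derivative g1 x) (at x)"
    and dec: "\<And>x y. 0 < x \<Longrightarrow> x \<le> y \<Longrightarrow> y \<le> 1 \<Longrightarrow> g1 y \<le> g1 x"
    and pos: "\<And>x. x \<in> {0<..1} \<Longrightarrow> 0 \<le> g1 x"
    and "0 < s" "s \<le> t" "t \<le> s'" "s' \<le> t'" "t' \<le> 1" "t' - s' \<le> t - s"
  shows "g t' - g s' \<le> g t - (g s :: real)"
proof (cases "s' = t'")
  case True
  then show ?thesis using deriv_nonneg_mono[OF d pos, of s t] assms by auto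
next
  case False
  then have lt: "s' < t'" "s < t" using assms by auto
  obtain x where x: "s < x" "x < t" "g t - g s = (t - s) * g1 x"
    using MVT2[OF lt(2), of g g1] d assms by force
  obtain y where y: "s' < y" "y < t'" "g t' - g s' = (t' - s') * g1 y"
    using MVT2[OF lt(1), of g g1] d assms by force
  have "(t' - s') * g1 y \<le> (t - s) * g1 x"
    using assms x y by (intro mult_mono dec pos) auto
  then show ?thesis using x y by simp
qed

lemma wA_dA: "0 < y \<Longrightarrow> 0 \<le> a \<Longrightarrow> 0 < b \<Longrightarrow> y * dA a b y = wA a b y * brA a b y"
  unfolding wA_def dA_def brA_def by (simp add: divide_simps power2_eq_square) (simp add: algebra_simps)

lemma wB_dB: "0 < y \<Longrightarrow> 0 \<le> a \<Longrightarrow> 0 < b \<Longrightarrow> y * dB a b y = wB a b y * brB a b y"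
proof -
  assume *: "0 < y" "0 \<le> a" "0 < b"
  have "1 + a * y > 0" "1 + b * y > 0" using * by (auto intro: add_pos_nonneg)
  then show ?thesis
  unfolding wB_def dB_def brB_def by (simp add: divide_simps power2_eq_square) (simp add: algebra_simps)
qed

lemma brA_bounds:
  assumes "0 \<le> a" "a < b" "0 < y"
  shows "a < brA a b y" "brA a b y < b" "0 < brA a b y"
proof -
  have "y * a < y * b" using assms by simp
  then show "a < brA a b y" "brA a b y < b" unfolding brA_def using assms
    by (auto simp: field_simps)
  then show "0 < brA a b y" using assms by linarith
qed

lemma brB_bounds:
  assumes "0 \<le> a" "a < b" "0 < y"
  shows "a < brB a b y" "brB a b y < b" "0 < brB a b y"
proof -
  have p: "1 + b * y > 0" "1 + a * y > 0" using assms by (auto intro: add_pos_nonneg)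
  show "a < brB a b y" "brB a b y < b" unfolding brB_def using assms p
    by (auto simp: field_simps)
  then show "0 < brB a b y" using assms by linarith
qed

text \<open>The step relation eliminates the position of the cell: for fixed \<open>y\<close> the
  distance between the paired points depends on \<open>a\<close> and \<open>b\<close> only through
  the gap \<open>b - a\<close>. This makes different cells comparable.\<close>

lemma brB_minus_brA:
  assumes "0 \<le> a" "0 < b" "0 < y" "b * (l - a) = 1"
  shows "brB a b y - brA a b y = (b - a) * (1 - y^2) / (1 + y^2 + y * (l + (b - a)))"
proof -
  have l: "l = a + 1 / b" using assms by (simp add: field_simps)
  have p: "1 + b * y > 0" "y + b > 0" using assms by (auto intro: add_pos_pos)
  have eq: "1 + y^2 + y * (l + (b - a)) = (1 + b * y) * (y + b) / b"
    unfolding l using assms by (simp add: field_simps power2_eq_square)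
  show ?thesis unfolding eq brB_def brA_def using p assms
    by (simp add: divide_simps) (simp add: algebra_simps power2_eq_square)
qed

section \<open>First and second derivatives of the terms of the averaging operator\<close>

lemma wA_term_deriv:
  assumes ab: "0 \<le> a" "a < b" "b \<le> 1" "0 < y"
    and g: "\<And>x. x \<in> {0<..1} \<Longrightarrow> (g has_real_derivative g1 x) (at x)"
  shows "((\<lambda>y. wA a b y * g (brA a b y)) has_real_derivative
     (a / (y + a)^2 - b / (y + b)^2) * g (brA a b y) + g1 (brA a b y) * dA a b y * wA a b y) (at y)"
proof -
  have "brA a b y \<in> {0<..1}" using brA_bounds[of a b y] ab by auto
  then show ?thesis using ab
    by (intro DERIV_mult wA_deriv DERIV_chain2[where g="brA a b"] g brA_deriv) auto
qed

lemma wB_term_deriv: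
  assumes ab: "0 \<le> a" "a < b" "b \<le> 1" "0 < y"
    and g: "\<And>x. x \<in> {0<..1} \<Longrightarrow> (g has_real_derivative g1 x) (at x)"
  shows "((\<lambda>y. wB a b y * g (brB a b y)) has_real_derivative
     (b / (1 + b * y)^2 - a / (1 + a * y)^2) * g (brB a b y) + g1 (brB a b y) * - dB a b y * wB a b y) (at y)"
proof -
  have p: "1 + b * y > 0" "1 + a * y > 0" using ab by (auto intro: add_pos_nonneg)
  have "brB a b y \<in> {0<..1}" using brB_bounds[of a b y] ab by auto
  then show ?thesis using ab p
    by (intro DERIV_mult wB_deriv DERIV_chain2[where g="brB a b"] g brB_deriv) auto
qed

lemma wA_term_deriv2:
  assumes ab: "0 \<le> a" "a < b" "b \<le> 1" "0 < y"
    and g: "\<And>x. x \<in> {0<..1} \<Longrightarrow> (g has_real_derivative g1 x) (at x)"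
    and g1: "\<And>x. x \<in> {0<..1} \<Longrightarrow> (g1 has_real_derivative g2 x) (at x)"
  shows "((\<lambda>y. (a / (y + a)^2 - b / (y + b)^2) * g (brA a b y) + g1 (brA a b y) * dA a b y * wA a b y)
    has_real_derivative
     (2 * b / (y + b)^3 - 2 * a / (y + a)^3) * g (brA a b y)
     + 2 * dA a b y * (a / (y + a)^2 - b / (y + b)^2 - wA a b y / (y + b)) * g1 (brA a b y)
     + wA a b y * (dA a b y)^2 * g2 (brA a b y)) (at y)"
proof -
  have i: "brA a b y \<in> {0<..1}" using brA_bounds[of a b y] ab by auto
  have "((\<lambda>y. (a / (y + a)^2 - b / (y + b)^2) * g (brA a b y) + g1 (brA a b y) * dA a b y * wA a b y)
    has_real_derivative
     ((2 * b / (y + b)^3 - 2 * a / (y + a)^3) * g (brA a b y)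
       + g1 (brA a b y) * dA a b y * (a / (y + a)^2 - b / (y + b)^2)) +
     ((g2 (brA a b y) * dA a b y * dA a b y + - (2 * dA a b y / (y + b)) * g1 (brA a b y)) * wA a b y
       + (a / (y + a)^2 - b / (y + b)^2) * (g1 (brA a b y) * dA a b y))) (at y)"
    using i ab
    by (intro DERIV_add DERIV_mult wA_deriv wA_deriv2 dA_deriv DERIV_chain2[where g="brA a b"] g g1 brA_deriv) auto
  then show ?thesis
    by (rule DERIV_cong) (simp add: algebra_simps power2_eq_square)
qed

lemma wB_term_deriv2:
  assumes ab: "0 \<le> a" "a < b" "b \<le> 1" "0 < y"
    and g: "\<And>x. x \<in> {0<..1} \<Longrightarrow> (g has_real_derivative g1 x) (at x)"
    and g1: "\<And>x. x \<in> {0<..1} \<Longrightarrow> (g1 has_real_derivative g2 x) (at x)"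
  shows "((\<lambda>y. (b / (1 + b * y)^2 - a / (1 + a * y)^2) * g (brB a b y) + g1 (brB a b y) * - dB a b y * wB a b y)
    has_real_derivative
     (2 * a^2 / (1 + a * y)^3 - 2 * b^2 / (1 + b * y)^3) * g (brB a b y)
     - 2 * dB a b y * (b / (1 + b * y)^2 - a / (1 + a * y)^2 - wB a b y * b / (1 + b * y)) * g1 (brB a b y)
     + wB a b y * (dB a b y)^2 * g2 (brB a b y)) (at y)"
proof -
  have p: "1 + b * y > 0" "1 + a * y > 0" using ab by (auto intro: add_pos_nonneg)
  have i: "brB a b y \<in> {0<..1}" using brB_bounds[of a b y] ab by auto
  have "((\<lambda>y. (b / (1 + b * y)^2 - a / (1 + a * y)^2) * g (brB a b y) + g1 (brB a b y) * - dB a b y * wB a b y)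
    has_real_derivative
     ((2 * a^2 / (1 + a * y)^3 - 2 * b^2 / (1 + b * y)^3) * g (brB a b y)
       + g1 (brB a b y) * - dB a b y * (b / (1 + b * y)^2 - a / (1 + a * y)^2)) +
     ((g2 (brB a b y) * - dB a b y * - dB a b y + - (- (2 * b * dB a b y / (1 + b * y))) * g1 (brB a b y)) * wB a b y
       + (b / (1 + b * y)^2 - a / (1 + a * y)^2) * (g1 (brB a b y) * - dB a b y))) (at y)"
    using i ab p
    by (intro DERIV_add DERIV_mult wB_deriv wB_deriv2 DERIV_minus dB_deriv DERIV_chain2[where g="brB a b"] g g1 brB_deriv) auto
  then show ?thesis
    by (rule DERIV_cong) (simp add: algebra_simps power2_eq_square)
qed

section \<open>Comparison of paired branches and signs of their coefficients\<close>

lemma wA_alt: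
  assumes "0 \<le> a" "0 < b" "0 < (y::real)"
  shows "wA a b y = y * (b - a) / ((y + a) * (y + b))"
  using assms unfolding wA_def by (simp add: divide_simps) (simp add: algebra_simps)

lemma wB_alt:
  assumes "0 \<le> a" "0 \<le> b" "0 \<le> (y::real)"
  shows "wB a b y = y * (b - a) / ((1 + a * y) * (1 + b * y))"
proof -
  have "1 + b * y > 0" "1 + a * y > 0" using assms by (auto intro: add_pos_nonneg)
  then show ?thesis unfolding wB_def by (simp add: divide_simps) (simp add: algebra_simps)
qed

text \<open>This is \<open>(1 - y) * (1 - b) \<ge> 0\<close>. It is the source of all comparisons
  below in which a \<open>brA\<close> quantity dominates its \<open>brB\<close> counterpart.\<close>

lemma add_le_one_add_mult:
  assumes "(y::real) \<le> 1" "b \<le> 1"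
  shows "y + b \<le> 1 + b * y"
  using mult_nonneg_nonneg[of "1 - y" "1 - b"] assms by (simp add: algebra_simps)

lemma wB_le_wA:
  assumes "0 \<le> a" "a < b" "b \<le> 1" "0 < y" "y \<le> 1"
  shows "0 \<le> wB a b y" "wB a b y \<le> wA a b y"
proof -
  have "1 + b * y > 0" "1 + a * y > 0" using assms by (auto intro: add_pos_nonneg)
  then show "0 \<le> wB a b y" using assms by (simp add: wB_alt)
  have "(y + a) * (y + b) \<le> (1 + a * y) * (1 + b * y)"
    using assms by (intro mult_mono add_le_one_add_mult) auto
  then show "wB a b y \<le> wA a b y" using assms by (simp add: wB_alt wA_alt frac_le)
qed

lemma dB_le_dA:
  assumes "0 \<le> a" "a < b" "b \<le> 1" "0 < y" "y \<le> 1"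
  shows "0 \<le> dB a b y" "dB a b y \<le> dA a b y"
proof -
  show "0 \<le> dB a b y" unfolding dB_def using assms by simp
  have "(y + b)^2 \<le> (1 + b * y)^2"
    using assms by (intro power_mono add_le_one_add_mult) auto
  then show "dB a b y \<le> dA a b y" unfolding dB_def dA_def using assms by (simp add: frac_le)
qed

text \<open>The sign is that of \<open>a * b - a * y - 2 * y^2\<close>: negative throughout for
  \<open>a = 0\<close>, but positive for small \<open>y\<close> as soon as \<open>a > 0\<close>.
  This is what prevents a proof of concavity cell by cell.\<close>

lemma cA_eq:
  assumes "0 \<le> a" "a < b" "0 < (y::real)"
  shows "2 * dA a b y * (a / (y + a)^2 - b / (y + b)^2 - wA a b y / (y + b))
    = - (2 * (b - a)^2 * b * (2 * y^2 + a * y - a * b) / ((y + a)^2 * (y + b)^4))"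
proof -
  have p: "y + a \<noteq> 0" "y + b \<noteq> 0" using assms by auto
  have "a / (y + a)^2 - b / (y + b)^2 - wA a b y / (y + b)
     = - ((b - a) * (2 * y^2 + a * y - a * b) / ((y + a)^2 * (y + b)^2))"
    using p assms by (simp add: wA_alt divide_simps) (simp add: algebra_simps power2_eq_square)
  then show ?thesis unfolding dA_def using p by (simp add: eval_nat_numeral mult_ac)
qed

text \<open>The coefficient enters the second derivative of \<open>T g\<close> with a minus sign, so
  it is harmful where \<open>b * y + 2 * a * b * y^2\<close> exceeds 1.\<close>

lemma cB_eq:
  assumes "0 \<le> a" "a < b" "0 < (y::real)"
  shows "2 * dB a b y * (b / (1 + b * y)^2 - a / (1 + a * y)^2 - wB a b y * b / (1 + b * y))
    = 2 * (b - a)^2 * b * (1 - b * y - 2 * a * b * y^2) / ((1 + a * y)^2 * (1 + b * y)^4)"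
proof -
  have p: "1 + b * y > 0" "1 + a * y > 0" using assms by (auto intro: add_pos_nonneg)
  have "b / (1 + b * y)^2 - a / (1 + a * y)^2 - wB a b y * b / (1 + b * y)
     = (b - a) * (1 - b * y - 2 * a * b * y^2) / ((1 + a * y)^2 * (1 + b * y)^2)"
    using p assms by (simp add: wB_alt divide_simps) (simp add: algebra_simps power2_eq_square)
  then show ?thesis unfolding dB_def using p by (simp add: eval_nat_numeral mult_ac)
qed

text \<open>
  The two bounds below control the terms with \<open>g'\<close> in the second derivative of \<open>T g\<close>: the first
  branch contributes negatively enough to absorb the possibly positive contributions of the others.
\<close>

lemma first_pair_bound:
  assumes "0 < b" "b \<le> 1" "0 < y" "y \<le> 1" "0 \<le> (q::real)"
  shows "2 * dA 0 b y * (0 / (y + 0)^2 - b / (y + b)^2 - wA 0 b y / (y + b)) * p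
     - 2 * dB 0 b y * (b / (1 + b * y)^2 - 0 / (1 + 0 * y)^2 - wB 0 b y * b / (1 + b * y)) * q
     \<le> - (4 * b^3 / (y + b)^4) * p"
proof -
  have "2 * dA 0 b y * (0 / (y + 0)^2 - b / (y + b)^2 - wA 0 b y / (y + b)) = - (4 * b^3 / (y + b)^4)"
    using assms by (subst cA_eq) (auto simp: power2_eq_square power3_eq_cube)
  moreover have "0 \<le> 2 * dB 0 b y * (b / (1 + b * y)^2 - 0 / (1 + 0 * y)^2 - wB 0 b y * b / (1 + b * y))"
    using assms mult_le_one[of b y] by (subst cB_eq) auto
  ultimately show ?thesis using assms(5) by (simp add: mult_nonneg_nonneg)
qed

lemma later_pair_bound:
  assumes ab: "0 \<le> a" "a < b" "b \<le> 1" and y: "0 < y" "y \<le> 1" and q: "0 \<le> (q::real)" "q \<le> p"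
    and rho: "1 / 2 \<le> \<rho>" "\<rho> \<le> a" "b - a \<le> \<rho>"
  shows "2 * dA a b y * (a / (y + a)^2 - b / (y + b)^2 - wA a b y / (y + b)) * p
     - 2 * dB a b y * (b / (1 + b * y)^2 - a / (1 + a * y)^2 - wB a b y * b / (1 + b * y)) * q
     \<le> 4 * (b - a) * \<rho>^2 / (y + \<rho>)^4 * p"
proof -
  define X where "X = 2 * (b - a)^2 * b"
  define U where "U = (y + a)^2 * (y + b)^4"
  define V where "V = (1 + a * y)^2 * (1 + b * y)^4"
  define E where "E = 2 * y^2 + a * y - a * b"
  define G where "G = 1 - b * y - 2 * a * b * y^2"
  have X: "0 \<le> X" using ab unfolding X_def by auto
  have U: "0 < U" using ab y unfolding U_def by auto
  have UV: "U \<le> V" unfolding U_def V_def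
    using ab y by (intro mult_mono power_mono add_le_one_add_mult) auto
  have rhs: "0 \<le> 4 * (b - a) * \<rho>^2 / (y + \<rho>)^4 * p" using ab y q rho by auto
  \<comment> \<open>\<open>E\<close> and \<open>G\<close> are the numerators that carry the signs
    for \<open>brA\<close> and \<open>brB\<close>. As their sum is nonnegative, at most one of the
    two terms has the wrong sign.\<close>
  have "E + G = (1 - a * b) * (2 * y^2) + (1 - b) * (1 + a) + (b - a) * (1 - y)"
    unfolding E_def G_def by (simp add: algebra_simps)
  moreover have "a * b \<le> 1" using ab mult_le_one[of a b] by auto
  ultimately have EG: "0 \<le> E + G" using ab y by simp
  have "- (X * E / U) * p - X * G / V * q \<le> 4 * (b - a) * \<rho>^2 / (y + \<rho>)^4 * p"
  proof (cases "0 \<le> E")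
    \<comment> \<open>The \<open>brA\<close> term has the good sign and absorbs the other one:
      \<open>E \<ge> - G\<close>, its denominator is smaller, and \<open>p \<ge> q\<close>.\<close>
    case True
    have "E / V * q \<le> E / U * p" using True U UV q by (intro mult_mono frac_le) auto
    moreover have "0 \<le> (E + G) / V * q" using EG U UV q by auto
    ultimately have "0 \<le> E / U * p + G / V * q" by (simp add: add_divide_distrib distrib_right)
    from mult_nonneg_nonneg[OF X this] show ?thesis using rhs by (simp add: algebra_simps)
  next
    \<comment> \<open>Now \<open>G\<close> is positive, so the \<open>brB\<close> term only helps,
      and the size of the \<open>brA\<close> term is estimated.\<close>
    case False
    then have "0 \<le> X * G / V * q" using EG X U UV q by auto
    moreover have "- (X * E / U) * p \<le> 4 * (b - a) * \<rho>^2 / (y + \<rho>)^4 * p"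
    proof (rule mult_right_mono)
      have "(b - a) * (b - a) \<le> (b - a) * \<rho>" using ab rho by (intro mult_left_mono) auto
      then have sq: "2 * ((b - a) * (b - a)) \<le> 2 * ((b - a) * \<rho>)" by linarith
      \<comment> \<open>Here \<open>a \<le> 1 \<le> 2 * \<rho>\<close> enters, that is, the lower
        bound 1/2 for \<open>\<rho>\<close>.\<close>
      have "a * b^2 \<le> (2 * \<rho>) * (y + b)^2" using ab y rho by (intro mult_mono power_mono) auto
      then have "2 * ((b - a) * (b - a)) * (a * b^2) \<le> 2 * ((b - a) * \<rho>) * ((2 * \<rho>) * (y + b)^2)"
        using ab rho by (intro mult_mono[OF sq]) auto
      moreover have "X * (- E) \<le> X * (a * b)" unfolding E_def using X ab y mult_nonneg_nonneg[of a y] zero_le_power2[of y]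
        by (intro mult_left_mono; linarith)
      ultimately have "X * (- E) \<le> 4 * (b - a) * \<rho>^2 * (y + b)^2"
      proof -
        assume h: "2 * ((b - a) * (b - a)) * (a * b^2) \<le> 2 * ((b - a) * \<rho>) * ((2 * \<rho>) * (y + b)^2)"
          "X * (- E) \<le> X * (a * b)"
        have l: "X * (a * b) = 2 * ((b - a) * (b - a)) * (a * b^2)"
          unfolding X_def by (simp add: power2_eq_square)
        have "2 * ((b - a) * \<rho>) * ((2 * \<rho>) * v) = 4 * (b - a) * \<rho>^2 * v" for v
          by (simp add: power2_eq_square algebra_simps)
        from h l this[of "(y + b)^2"] show ?thesis by linarith
      qed
      then have "X * (- E) / U \<le> 4 * (b - a) * \<rho>^2 * (y + b)^2 / U"
        using U by (intro divide_right_mono) auto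
      also have "\<dots> = 4 * (b - a) * \<rho>^2 / ((y + a)^2 * (y + b)^2)"
        unfolding U_def using ab y by (simp add: divide_simps eval_nat_numeral)
      also have "\<dots> \<le> 4 * (b - a) * \<rho>^2 / (y + \<rho>)^4"
      proof (rule divide_left_mono)
        have "(y + \<rho>)^2 * (y + \<rho>)^2 \<le> (y + a)^2 * (y + b)^2"
          using ab y rho by (intro mult_mono power_mono) auto
        then show "(y + \<rho>)^4 \<le> (y + a)^2 * (y + b)^2" by (simp add: eval_nat_numeral mult_ac)
      qed (use ab y rho in auto)
      finally show "- (X * E / U) \<le> 4 * (b - a) * \<rho>^2 / (y + \<rho>)^4" by simp
    qed (use q in auto)
    ultimately show ?thesis by simp
  qed
  then show ?thesis unfolding X_def U_def V_def E_def G_def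
    using ab y by (subst cA_eq, simp, simp, simp, subst cB_eq) auto
qed

text \<open>\<open>l\<close> stands for \<open>2 * cos (pi / q)\<close>, and \<open>r_step\<close>
  is the three-term recurrence of the sines written for ratios of consecutive values. The bound
  \<open>l \<le> 2\<close> acts through its consequence \<open>1 / 2 \<le> r 1\<close>.\<close>

locale hecke_partition =
  fixes N :: nat and r :: "nat \<Rightarrow> real" and l :: real
  assumes N_pos: "0 < N" and r_0: "r 0 = 0" and r_N: "r N = 1" and l_le_2: "l \<le> 2"
    and r_less: "\<And>i. i < N \<Longrightarrow> r i < r (Suc i)"
    and r_step: "\<And>i. i < N \<Longrightarrow> r (Suc i) * (l - r i) = 1"
begin

section \<open>Geometry of the partition and order of the branch points\<close>

lemma r_mono: "i \<le> j \<Longrightarrow> j \<le> N \<Longrightarrow> r i \<le> r j"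
proof (induction j rule: dec_induct)
  case (step n)
  then show ?case using r_less[of n] by simp
qed simp

lemma r_nonneg: "i \<le> N \<Longrightarrow> 0 \<le> r i"
  using r_mono[of 0 i] r_0 by simp

lemma r_le_1: "i \<le> N \<Longrightarrow> r i \<le> 1"
  using r_mono[of i N] r_N by simp

lemma r_branch: "i < N \<Longrightarrow> 0 \<le> r i \<and> r i < r (Suc i) \<and> r (Suc i) \<le> 1"
  using r_nonneg[of i] r_less[of i] r_le_1[of "Suc i"] by simp

lemma r_pos: "0 < i \<Longrightarrow> i \<le> N \<Longrightarrow> 0 < r i"
  using r_branch[of "i - 1"] by (cases i) auto

lemma r_1: "r 1 * l = 1" "1 / 2 \<le> r 1" "r 1 \<le> 1" "1 \<le> l"
proof -
  show *: "r 1 * l = 1" using r_step[of 0] N_pos r_0 by simp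
  have p: "0 < r 1" "r 1 \<le> 1" using r_branch[of 0] N_pos r_0 by auto
  then show "r 1 \<le> 1" by simp
  have "r 1 * l \<le> r 1 * 2" using p l_le_2 by (intro mult_left_mono) auto
  then show "1 / 2 \<le> r 1" using * by simp
  have l: "l = 1 / r 1" using * p by (simp add: field_simps)
  show "1 \<le> l" unfolding l using p by simp
qed

text \<open>Inserting the two step relations as factors 1 gives
  \<open>c - b = b * c * (b - a)\<close> for consecutive points, and
  \<open>b * c \<le> 1\<close>.\<close>

lemma gap_decreasing:
  assumes "Suc i < N"
  shows "r (Suc (Suc i)) - r (Suc i) \<le> r (Suc i) - r i"
proof -
  define a b c where "a = r i" and "b = r (Suc i)" and "c = r (Suc (Suc i))"
  have s: "b * (l - a) = 1" "c * (l - b) = 1"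
    using r_step[of i] r_step[of "Suc i"] assms unfolding a_def b_def c_def by auto
  have o: "0 \<le> a" "a < b" "b < c" "c \<le> 1"
    using r_branch[of i] r_branch[of "Suc i"] assms unfolding a_def b_def c_def by auto
  have "c - b = c * (b * (l - a)) - b * (c * (l - b))" using s by simp
  also have "\<dots> = (b * c) * (b - a)" by (simp add: algebra_simps)
  also have "\<dots> \<le> 1 * (b - a)" using o by (intro mult_right_mono mult_le_one) auto
  finally show ?thesis unfolding a_def b_def c_def by simp
qed

lemma gap_le_r_1:
  assumes "i < N"
  shows "r (Suc i) - r i \<le> r 1"
  using assms
proof (induction i)
  case (Suc i)
  then show ?case using gap_decreasing[of i] by simp
qed (simp add: r_0)

definition T :: "(real \<Rightarrow> real) \<Rightarrow> real \<Rightarrow> real" where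
  "T g y = (\<Sum>i<N. wA (r i) (r (Suc i)) y * g (brA (r i) (r (Suc i)) y)
                  + wB (r i) (r (Suc i)) y * g (brB (r i) (r (Suc i)) y))"

lemma brA_le_brB:
  assumes "i < N" "0 < y" "y \<le> 1"
  shows "brA (r i) (r (Suc i)) y \<le> brB (r i) (r (Suc i)) y"
proof -
  have y2: "y^2 \<le> 1" using assms by (simp add: power_le_one)
  have "0 \<le> brB (r i) (r (Suc i)) y - brA (r i) (r (Suc i)) y"
    using brB_minus_brA[of "r i" "r (Suc i)" y l] r_branch[of i] r_step[of i] assms y2 r_1
    by (auto intro!: divide_nonneg_nonneg add_nonneg_nonneg mult_nonneg_nonneg)
  then show ?thesis by simp
qed

text \<open>For the second claim, a cell of length \<open>d\<close> separates its paired points by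
  \<open>(1 - y^2) * (d / (c + y * d))\<close> with \<open>c\<close> independent of the cell. This
  increases with \<open>d\<close>, and the cells shrink to the right.\<close>

lemma branch_order:
  assumes "Suc i < N" "0 < y" "y \<le> 1"
  shows "brB (r i) (r (Suc i)) y \<le> brA (r (Suc i)) (r (Suc (Suc i))) y"
    "brB (r (Suc i)) (r (Suc (Suc i))) y - brA (r (Suc i)) (r (Suc (Suc i))) y
      \<le> brB (r i) (r (Suc i)) y - brA (r i) (r (Suc i)) y"
proof -
  note b = r_branch[of i] r_branch[of "Suc i"]
  have y2: "y^2 \<le> 1" using assms by (simp add: power_le_one)
  show "brB (r i) (r (Suc i)) y \<le> brA (r (Suc i)) (r (Suc (Suc i))) y"
    using brB_bounds[of "r i" "r (Suc i)" y] brA_bounds[of "r (Suc i)" "r (Suc (Suc i))" y] b assms by auto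
  define c where "c = 1 + y^2 + y * l"
  have c: "0 < c" using r_1 assms by (simp add: c_def add_pos_pos)
  have diff: "brB (r j) (r (Suc j)) y - brA (r j) (r (Suc j)) y
      = (1 - y^2) * ((r (Suc j) - r j) / (c + y * (r (Suc j) - r j)))" if "j < N" for j
    unfolding c_def using brB_minus_brA[of "r j" "r (Suc j)" y l] r_branch[of j] r_step[of j] that assms
    by (simp add: algebra_simps)
  have frac_mono: "d / (c + y * d) \<le> e / (c + y * e)" if "0 \<le> d" "d \<le> e" for d e
  proof -
    have "0 < c + y * d" "0 < c + y * e" using c that assms by (auto intro!: add_pos_nonneg)
    then show ?thesis using that c by (simp add: divide_simps) (simp add: algebra_simps mult_right_mono)
  qed
  show "brB (r (Suc i)) (r (Suc (Suc i))) y - brA (r (Suc i)) (r (Suc (Suc i))) y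
      \<le> brB (r i) (r (Suc i)) y - brA (r i) (r (Suc i)) y"
    unfolding diff[OF assms(1)] diff[OF Suc_lessD[OF assms(1)]]
    using gap_decreasing[of i] b assms y2 by (intro mult_left_mono frac_mono) auto
qed

end

section \<open>Increasing concave functions under the transfer operator\<close>

context hecke_partition
begin

text \<open>The intervals between paired points move to the right and shrink, so concavity makes the
  increment of \<open>g\<close> over them decrease. Rearranged, the increments along the
  \<open>brB\<close> points are at most those along the \<open>brA\<close> points, as summation by
  parts requires.\<close>

lemma branch_increments:
  assumes d: "\<And>x. x \<in> {0<..1} \<Longrightarrow> (g has_real_derivative g1 x) (at x)"
    and dec: "\<And>x y. 0 < x \<Longrightarrow> x \<le> y \<Longrightarrow> y \<le> 1 \<Longrightarrow> g1 y \<le> g1 x"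
    and pos: "\<And>x. x \<in> {0<..1} \<Longrightarrow> 0 \<le> g1 x"
    and i: "Suc i < N" and y: "0 < y" "y \<le> 1"
  shows "0 \<le> g (brB (r (Suc i)) (r (Suc (Suc i))) y) - g (brB (r i) (r (Suc i)) y)"
    "g (brB (r (Suc i)) (r (Suc (Suc i))) y) - g (brB (r i) (r (Suc i)) y)
     \<le> g (brA (r (Suc i)) (r (Suc (Suc i))) y) - g (brA (r i) (r (Suc i)) y)"
proof -
  note b = r_branch[of i] r_branch[of "Suc i"]
  note o = branch_order[OF i y] brA_le_brB[OF Suc_lessD[OF i] y] brA_le_brB[OF i y]
  have bd: "0 < brA (r i) (r (Suc i)) y" "brB (r (Suc i)) (r (Suc (Suc i))) y \<le> 1"
    using brA_bounds[of "r i" "r (Suc i)" y] brB_bounds[of "r (Suc i)" "r (Suc (Suc i))" y] b i y by auto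
  show "0 \<le> g (brB (r (Suc i)) (r (Suc (Suc i))) y) - g (brB (r i) (r (Suc i)) y)"
    using deriv_nonneg_mono[OF d pos, of "brB (r i) (r (Suc i)) y" "brB (r (Suc i)) (r (Suc (Suc i))) y"]
      o bd by auto
  have "g (brB (r (Suc i)) (r (Suc (Suc i))) y) - g (brA (r (Suc i)) (r (Suc (Suc i))) y)
     \<le> g (brB (r i) (r (Suc i)) y) - g (brA (r i) (r (Suc i)) y)"
    by (rule concave_increments[OF d dec pos]) (use o bd in auto)
  then show "g (brB (r (Suc i)) (r (Suc (Suc i))) y) - g (brB (r i) (r (Suc i)) y)
     \<le> g (brA (r (Suc i)) (r (Suc (Suc i))) y) - g (brA (r i) (r (Suc i)) y)" by simp
qed

text \<open>The differentiated weights form a sum to which \<open>abel_two_sequences_nonneg\<close>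
  applies, with \<open>c\<close> and \<open>e\<close> agreeing at the last point 1. The
  differentiated branches give in each cell a \<open>brA\<close> term dominating the negative
  \<open>brB\<close> term, because slope, Jacobian and weight are all larger for
  \<open>brA\<close>.\<close>

lemma T_deriv_nonneg:
  assumes d: "\<And>x. x \<in> {0<..1} \<Longrightarrow> (g has_real_derivative g1 x) (at x)"
    and dec: "\<And>x y. 0 < x \<Longrightarrow> x \<le> y \<Longrightarrow> y \<le> 1 \<Longrightarrow> g1 y \<le> g1 x"
    and pos: "\<And>x. x \<in> {0<..1} \<Longrightarrow> 0 \<le> g1 x"
    and y: "0 < y" "y \<le> 1"
  shows "0 \<le> (\<Sum>i<N.
     (r i / (y + r i)^2 - r (Suc i) / (y + r (Suc i))^2) * g (brA (r i) (r (Suc i)) y)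
       + g1 (brA (r i) (r (Suc i)) y) * dA (r i) (r (Suc i)) y * wA (r i) (r (Suc i)) y
     + ((r (Suc i) / (1 + r (Suc i) * y)^2 - r i / (1 + r i * y)^2) * g (brB (r i) (r (Suc i)) y)
       + g1 (brB (r i) (r (Suc i)) y) * - dB (r i) (r (Suc i)) y * wB (r i) (r (Suc i)) y))"
    (is "0 \<le> sum ?f _")
proof -
  define c e where "c i = r i / (y + r i)^2" and "e i = r i / (1 + r i * y)^2" for i
  define G H where "G i = g (brA (r i) (r (Suc i)) y)" and "H i = g (brB (r i) (r (Suc i)) y)" for i
  define R where "R i = g1 (brA (r i) (r (Suc i)) y) * (dA (r i) (r (Suc i)) y * wA (r i) (r (Suc i)) y)
    - g1 (brB (r i) (r (Suc i)) y) * (dB (r i) (r (Suc i)) y * wB (r i) (r (Suc i)) y)" for i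
  have "0 \<le> (\<Sum>i<N. (c i - c (Suc i)) * G i + (e (Suc i) - e i) * H i)"
  proof (rule abel_two_sequences_nonneg[OF N_pos])
    show "c 0 = 0" "e 0 = 0" "c N = e N" unfolding c_def e_def r_0 r_N by (auto simp: add.commute)
    show "0 \<le> e i \<and> e i \<le> c i" if "i \<le> N" for i
    proof (cases "i = 0")
      case False
      then have "0 < r i" using that r_pos by simp
      moreover have "(y + r i)^2 \<le> (1 + r i * y)^2"
        using calculation y r_le_1[OF that] by (intro power_mono add_le_one_add_mult) auto
      ultimately have "e i \<le> c i" unfolding c_def e_def using y by (intro frac_le) auto
      then show ?thesis unfolding e_def using \<open>0 < r i\<close> y by simp
    qed (simp add: c_def e_def r_0)
    show "0 \<le> H (Suc i) - H i \<and> H (Suc i) - H i \<le> G (Suc i) - G i" if "Suc i < N" for i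
      using branch_increments[OF d dec pos that y] unfolding G_def H_def by auto
    show "G i \<le> H i" if "i < N" for i
      unfolding G_def H_def
      by (rule deriv_nonneg_mono[OF d pos])
        (use brA_le_brB[OF that y] brA_bounds[of "r i" "r (Suc i)" y] brB_bounds[of "r i" "r (Suc i)" y]
          r_branch[OF that] y in auto)
  qed
  moreover have "0 \<le> (\<Sum>i<N. R i)"
  proof (rule sum_nonneg)
    fix i assume "i \<in> {..<N}"
    then have i: "i < N" by simp
    note b = r_branch[OF i]
    have bd: "0 < brA (r i) (r (Suc i)) y" "brB (r i) (r (Suc i)) y \<le> 1"
      using brA_bounds[of "r i" "r (Suc i)" y] brB_bounds[of "r i" "r (Suc i)" y] b y by auto
    have "g1 (brB (r i) (r (Suc i)) y) * (dB (r i) (r (Suc i)) y * wB (r i) (r (Suc i)) y)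
      \<le> g1 (brA (r i) (r (Suc i)) y) * (dA (r i) (r (Suc i)) y * wA (r i) (r (Suc i)) y)"
    proof (rule mult_mono)
      show "g1 (brB (r i) (r (Suc i)) y) \<le> g1 (brA (r i) (r (Suc i)) y)"
        using dec bd brA_le_brB[OF i y] by auto
      show "0 \<le> g1 (brA (r i) (r (Suc i)) y)" using pos bd brA_le_brB[OF i y] by auto
      show "dB (r i) (r (Suc i)) y * wB (r i) (r (Suc i)) y \<le> dA (r i) (r (Suc i)) y * wA (r i) (r (Suc i)) y"
        using dB_le_dA[of "r i" "r (Suc i)" y] wB_le_wA[of "r i" "r (Suc i)" y] b y by (intro mult_mono) auto
      show "0 \<le> dB (r i) (r (Suc i)) y * wB (r i) (r (Suc i)) y"
        using dB_le_dA[of "r i" "r (Suc i)" y] wB_le_wA[of "r i" "r (Suc i)" y] b y by auto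
    qed
    then show "0 \<le> R i" unfolding R_def by simp
  qed
  moreover have "sum ?f {..<N} = (\<Sum>i<N. (c i - c (Suc i)) * G i + (e (Suc i) - e i) * H i) + (\<Sum>i<N. R i)"
    unfolding sum.distrib[symmetric] c_def e_def G_def H_def R_def
    by (intro sum.cong refl) (simp add: mult.assoc)
  ultimately show ?thesis by simp
qed

text \<open>The weight part \<open>c\<close>, \<open>e\<close> is again summed by parts, and the
  part \<open>Z\<close> with \<open>g2\<close> has a sign. The delicate part is \<open>R\<close>,
  with \<open>g1\<close>: later cells may contribute positively, each at most in proportion to its
  length, and the first cell pays for all of them.\<close>

lemma T_deriv2_nonpos:
  assumes d: "\<And>x. x \<in> {0<..1} \<Longrightarrow> (g has_real_derivative g1 x) (at x)"
    and dec: "\<And>x y. 0 < x \<Longrightarrow> x \<le> y \<Longrightarrow> y \<le> 1 \<Longrightarrow> g1 y \<le> g1 x"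
    and pos: "\<And>x. x \<in> {0<..1} \<Longrightarrow> 0 \<le> g1 x"
    and neg: "\<And>x. x \<in> {0<..1} \<Longrightarrow> g2 x \<le> 0"
    and y: "0 < y" "y \<le> 1"
  shows "(\<Sum>i<N.
     (2 * r (Suc i) / (y + r (Suc i))^3 - 2 * r i / (y + r i)^3) * g (brA (r i) (r (Suc i)) y)
     + 2 * dA (r i) (r (Suc i)) y * (r i / (y + r i)^2 - r (Suc i) / (y + r (Suc i))^2
          - wA (r i) (r (Suc i)) y / (y + r (Suc i))) * g1 (brA (r i) (r (Suc i)) y)
     + wA (r i) (r (Suc i)) y * (dA (r i) (r (Suc i)) y)^2 * g2 (brA (r i) (r (Suc i)) y)
     + ((2 * (r i)^2 / (1 + r i * y)^3 - 2 * (r (Suc i))^2 / (1 + r (Suc i) * y)^3) * g (brB (r i) (r (Suc i)) y)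
     - 2 * dB (r i) (r (Suc i)) y * (r (Suc i) / (1 + r (Suc i) * y)^2 - r i / (1 + r i * y)^2
          - wB (r i) (r (Suc i)) y * r (Suc i) / (1 + r (Suc i) * y)) * g1 (brB (r i) (r (Suc i)) y)
     + wB (r i) (r (Suc i)) y * (dB (r i) (r (Suc i)) y)^2 * g2 (brB (r i) (r (Suc i)) y))) \<le> 0"
    (is "sum ?f _ \<le> 0")
proof -
  define c e where "c i = 2 * r i / (y + r i)^3" and "e i = 2 * (r i)^2 / (1 + r i * y)^3" for i
  define G H where "G i = g (brA (r i) (r (Suc i)) y)" and "H i = g (brB (r i) (r (Suc i)) y)" for i
  define p q where "p i = g1 (brA (r i) (r (Suc i)) y)" and "q i = g1 (brB (r i) (r (Suc i)) y)" for i
  define R where "R i = 2 * dA (r i) (r (Suc i)) y * (r i / (y + r i)^2 - r (Suc i) / (y + r (Suc i))^2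
          - wA (r i) (r (Suc i)) y / (y + r (Suc i))) * p i
     - 2 * dB (r i) (r (Suc i)) y * (r (Suc i) / (1 + r (Suc i) * y)^2 - r i / (1 + r i * y)^2
          - wB (r i) (r (Suc i)) y * r (Suc i) / (1 + r (Suc i) * y)) * q i" for i
  define Z where "Z i = wA (r i) (r (Suc i)) y * (dA (r i) (r (Suc i)) y)^2 * g2 (brA (r i) (r (Suc i)) y)
     + wB (r i) (r (Suc i)) y * (dB (r i) (r (Suc i)) y)^2 * g2 (brB (r i) (r (Suc i)) y)" for i
  have bd: "0 < brA (r i) (r (Suc i)) y" "brA (r i) (r (Suc i)) y \<le> brB (r i) (r (Suc i)) y"
      "brB (r i) (r (Suc i)) y \<le> 1" if "i < N" for i
    using brA_bounds[of "r i" "r (Suc i)" y] brB_bounds[of "r i" "r (Suc i)" y] brA_le_brB[OF that y]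
      r_branch[OF that] y by auto
  have "0 \<le> (\<Sum>i<N. (c i - c (Suc i)) * G i + (e (Suc i) - e i) * H i)"
  proof (rule abel_two_sequences_nonneg[OF N_pos])
    show "c 0 = 0" "e 0 = 0" "c N = e N" unfolding c_def e_def r_0 r_N by (auto simp: add.commute)
    show "0 \<le> e i \<and> e i \<le> c i" if "i \<le> N" for i
    proof (cases "i = 0")
      case False
      then have ri: "0 < r i" using that r_pos by simp
      have "2 * (r i)^2 \<le> 2 * r i"
        using ri r_le_1[OF that] mult_left_mono[of "r i" 1 "r i"] by (simp add: power2_eq_square)
      moreover have "(y + r i)^3 \<le> (1 + r i * y)^3"
        using ri y r_le_1[OF that] by (intro power_mono add_le_one_add_mult) auto
      ultimately have "e i \<le> c i" unfolding c_def e_def using ri y by (intro frac_le) auto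
      then show ?thesis unfolding e_def using ri y by simp
    qed (simp add: c_def e_def r_0)
    show "0 \<le> H (Suc i) - H i \<and> H (Suc i) - H i \<le> G (Suc i) - G i" if "Suc i < N" for i
      using branch_increments[OF d dec pos that y] unfolding G_def H_def by auto
    show "G i \<le> H i" if "i < N" for i
      unfolding G_def H_def by (rule deriv_nonneg_mono[OF d pos]) (use bd[OF that] in auto)
  qed
  moreover have "(\<Sum>i<N. R i) \<le> 0"
  proof -
    \<comment> \<open>The factor common to \<open>first_pair_bound\<close> and, with
      \<open>\<rho> = r 1\<close>, to \<open>later_pair_bound\<close>.\<close>
    define k where "k = 4 * (r 1)^2 / (y + r 1)^4"
    obtain M where M: "N = Suc M" using N_pos by (cases N) auto
    have k: "0 \<le> k" unfolding k_def using r_1 y by simp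
    have p0: "0 \<le> p 0" unfolding p_def using pos bd[of 0] N_pos by simp
    have q: "0 \<le> q i" "q i \<le> p i" if "i < N" for i
      unfolding p_def q_def using bd[OF that] pos dec by auto
    have "R 0 \<le> - (4 * (r 1)^3 / (y + r 1)^4) * p 0"
      unfolding R_def r_0 using first_pair_bound[of "r 1" y "q 0" "p 0"] r_1 y q[of 0] N_pos by simp
    also have "\<dots> = - (k * r 1 * p 0)" unfolding k_def by (simp add: eval_nat_numeral)
    finally have R0: "R 0 \<le> - (k * r 1 * p 0)" .
    have "R (Suc i) \<le> (r (Suc (Suc i)) - r (Suc i)) * (k * p 0)" if "i < M" for i
    proof -
      have i: "Suc i < N" using that M by simp
      have "R (Suc i) \<le> 4 * (r (Suc (Suc i)) - r (Suc i)) * (r 1)^2 / (y + r 1)^4 * p (Suc i)"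
        unfolding R_def
        by (rule later_pair_bound)
          (use r_branch[OF i] r_mono[of 1 "Suc i"] gap_le_r_1[OF i] q[OF i] r_1 y i in auto)
      also have "\<dots> = (r (Suc (Suc i)) - r (Suc i)) * (k * p (Suc i))" unfolding k_def by simp
      also have "\<dots> \<le> (r (Suc (Suc i)) - r (Suc i)) * (k * p 0)"
      proof (intro mult_left_mono)
        have "brA (r 0) (r (Suc 0)) y < r 1"
          using brA_bounds[of "r 0" "r (Suc 0)" y] r_branch[of 0] N_pos y by auto
        also have "\<dots> \<le> r (Suc i)" using r_mono[of 1 "Suc i"] i by auto
        also have "\<dots> < brA (r (Suc i)) (r (Suc (Suc i))) y"
          using brA_bounds[of "r (Suc i)" "r (Suc (Suc i))" y] r_branch[OF i] y by auto
        finally show "p (Suc i) \<le> p 0" unfolding p_def using dec bd[OF i] bd[OF N_pos] by auto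
      qed (use k r_branch[OF i] in auto)
      finally show ?thesis .
    qed
    then have "(\<Sum>i<M. R (Suc i)) \<le> (\<Sum>i<M. (r (Suc (Suc i)) - r (Suc i)) * (k * p 0))"
      by (intro sum_mono) auto
    also have "\<dots> = (1 - r 1) * (k * p 0)"
      unfolding sum_distrib_right[symmetric] using sum_lessThan_telescope[of "\<lambda>i. r (Suc i)" M] r_N M by simp
    \<comment> \<open>The balance of the argument: the total length of the later cells is at most
      that of the first one, because \<open>r 1 \<ge> 1 / 2\<close>.\<close>
    also have "\<dots> \<le> r 1 * (k * p 0)" using r_1 k p0 by (intro mult_right_mono) auto
    finally show ?thesis using R0 unfolding M sum.lessThan_Suc_shift by (simp add: mult_ac)
  qed
  moreover have "(\<Sum>i<N. Z i) \<le> 0"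
  proof (rule sum_nonpos)
    fix i assume "i \<in> {..<N}"
    then have i: "i < N" by simp
    have w: "0 \<le> wA (r i) (r (Suc i)) y" "0 \<le> wB (r i) (r (Suc i)) y"
      using wB_le_wA[of "r i" "r (Suc i)" y] r_branch[OF i] y by auto
    have "g2 (brA (r i) (r (Suc i)) y) \<le> 0" "g2 (brB (r i) (r (Suc i)) y) \<le> 0"
      using neg bd[OF i] by auto
    then show "Z i \<le> 0" unfolding Z_def using w by (intro add_nonpos_nonpos mult_nonneg_nonpos) auto
  qed
  moreover have "sum ?f {..<N} = - (\<Sum>i<N. (c i - c (Suc i)) * G i + (e (Suc i) - e i) * H i)
     + (\<Sum>i<N. R i) + (\<Sum>i<N. Z i)"
    unfolding sum.distrib[symmetric] sum_negf[symmetric] c_def e_def G_def H_def R_def Z_def p_def q_def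
    by (intro sum.cong refl) (simp add: left_diff_distrib)
  ultimately show ?thesis by linarith
qed

lemma T_incr_concave:
  assumes "incr_concave g"
  shows "incr_concave (T g)"
proof -
  obtain g1 g2 where g: "\<forall>x\<in>{0<..1}. (g has_real_derivative g1 x) (at x)
     \<and> (g1 has_real_derivative g2 x) (at x) \<and> 0 \<le> g1 x \<and> g2 x \<le> 0"
    using assms incr_concave_def by auto
  have dec: "g1 t \<le> g1 s" if "0 < s" "s \<le> t" "t \<le> 1" for s t
  proof -
    have "- g1 s \<le> - g1 t"
    proof (rule deriv_nonneg_mono[of "\<lambda>x. - g1 x" "\<lambda>x. - g2 x"])
      show "((\<lambda>x. - g1 x) has_real_derivative - g2 x) (at x)" if "x \<in> {0<..1}" for x
        using g that by (intro DERIV_minus) auto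
    qed (use g that in auto)
    then show ?thesis by simp
  qed
  define D1 where "D1 y = (\<Sum>i<N.
     (r i / (y + r i)^2 - r (Suc i) / (y + r (Suc i))^2) * g (brA (r i) (r (Suc i)) y)
       + g1 (brA (r i) (r (Suc i)) y) * dA (r i) (r (Suc i)) y * wA (r i) (r (Suc i)) y
     + ((r (Suc i) / (1 + r (Suc i) * y)^2 - r i / (1 + r i * y)^2) * g (brB (r i) (r (Suc i)) y)
       + g1 (brB (r i) (r (Suc i)) y) * - dB (r i) (r (Suc i)) y * wB (r i) (r (Suc i)) y))" for y
  define D2 where "D2 y = (\<Sum>i<N.
     (2 * r (Suc i) / (y + r (Suc i))^3 - 2 * r i / (y + r i)^3) * g (brA (r i) (r (Suc i)) y)
     + 2 * dA (r i) (r (Suc i)) y * (r i / (y + r i)^2 - r (Suc i) / (y + r (Suc i))^2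
          - wA (r i) (r (Suc i)) y / (y + r (Suc i))) * g1 (brA (r i) (r (Suc i)) y)
     + wA (r i) (r (Suc i)) y * (dA (r i) (r (Suc i)) y)^2 * g2 (brA (r i) (r (Suc i)) y)
     + ((2 * (r i)^2 / (1 + r i * y)^3 - 2 * (r (Suc i))^2 / (1 + r (Suc i) * y)^3) * g (brB (r i) (r (Suc i)) y)
     - 2 * dB (r i) (r (Suc i)) y * (r (Suc i) / (1 + r (Suc i) * y)^2 - r i / (1 + r i * y)^2
          - wB (r i) (r (Suc i)) y * r (Suc i) / (1 + r (Suc i) * y)) * g1 (brB (r i) (r (Suc i)) y)
     + wB (r i) (r (Suc i)) y * (dB (r i) (r (Suc i)) y)^2 * g2 (brB (r i) (r (Suc i)) y)))" for y
  have "(T g has_real_derivative D1 y) (at y)" if "y \<in> {0<..1}" for y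
    unfolding T_def[abs_def] D1_def
    by (intro DERIV_sum DERIV_add wA_term_deriv wB_term_deriv) (use g r_branch that in auto)
  moreover have "(D1 has_real_derivative D2 y) (at y)" if "y \<in> {0<..1}" for y
    unfolding D1_def[abs_def] D2_def
    by (rule DERIV_sum, rule DERIV_add, rule wA_term_deriv2[where ?g1.0=g1], (use g r_branch that in auto)[6],
        rule wB_term_deriv2[where ?g1.0=g1], use g r_branch that in auto)
  moreover have "0 \<le> D1 y" if "y \<in> {0<..1}" for y
    unfolding D1_def by (rule T_deriv_nonneg) (use g dec that in auto)
  moreover have "D2 y \<le> 0" if "y \<in> {0<..1}" for y
    unfolding D2_def by (rule T_deriv2_nonpos) (use g dec that in auto)
  ultimately show ?thesis unfolding incr_concave_def by blast
qed

end

section \<open>Asymptotics of renewal type densities\<close>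

text \<open>Tannery's theorem: after extension by zero the \<open>k\<close>-th term tends to 0 as
  \<open>n\<close> grows, and it is dominated by the summable \<open>C * d k\<close>.\<close>

lemma convolution_tendsto_0:
  fixes d \<delta> :: "nat \<Rightarrow> real"
  assumes "summable d" "\<And>k. 0 \<le> d k" "\<And>k. 0 \<le> \<delta> k" "\<And>k. \<delta> k \<le> C" "\<delta> \<longlonglongrightarrow> 0"
  shows "(\<lambda>n. \<Sum>k<n. \<delta> (n - Suc k) * d k) \<longlonglongrightarrow> 0"
proof -
  define a where "a k n = (if k < n then \<delta> (n - Suc k) * d k else 0)" for k n
  have lim: "(\<lambda>n. a k n) \<longlonglongrightarrow> 0" for k
  proof -
    have "(\<lambda>n. \<delta> n * d k) \<longlonglongrightarrow> 0" using tendsto_mult_left_zero[OF assms(5)] .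
    then have "(\<lambda>n. a k (n + Suc k)) \<longlonglongrightarrow> 0" by (simp add: a_def)
    then show ?thesis by (rule LIMSEQ_offset)
  qed
  have bd: "norm (a k n) \<le> C * d k" for k n
  proof -
    have "0 \<le> C" using order_trans[OF assms(3,4)] .
    then show ?thesis using assms(2-4) by (auto simp: a_def abs_mult intro!: mult_right_mono)
  qed
  have "(\<lambda>n. suminf (\<lambda>k. a k n)) \<longlonglongrightarrow> suminf (\<lambda>_. 0)"
    using tannerys_theorem[of a "\<lambda>_. 0" sequentially "\<lambda>k. C * d k"] lim bd assms(1)
    by (auto intro!: always_eventually)
  moreover have "suminf (\<lambda>k. a k n) = (\<Sum>k<n. \<delta> (n - Suc k) * d k)" for n
    by (subst suminf_finite[of "{..<n}"]) (auto simp: a_def)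
  ultimately show ?thesis by simp
qed

lemma cesaro_null:
  fixes u :: "nat \<Rightarrow> real"
  assumes "u \<longlonglongrightarrow> 0" "\<And>n. 0 \<le> u n" "\<And>n. u n \<le> C"
  shows "(\<lambda>n. (\<Sum>k<n. u k) / real n) \<longlonglongrightarrow> 0"
proof (rule LIMSEQ_I)
  fix \<epsilon> :: real assume e: "0 < \<epsilon>"
  then obtain K where K: "\<And>n. n \<ge> K \<Longrightarrow> u n < \<epsilon> / 2"
    using LIMSEQ_D[OF assms(1), of "\<epsilon> / 2"] assms(2) by auto
  obtain K' where K': "2 * real K * C / \<epsilon> < real K'" using reals_Archimedean2 by blast
  show "\<exists>no. \<forall>n\<ge>no. norm ((\<Sum>k<n. u k) / real n - 0) < \<epsilon>"
  proof (intro exI allI impI)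
    fix n assume n: "Suc (max K K') \<le> n"
    have "(\<Sum>k<n. u k) \<le> (\<Sum>k<n. \<epsilon> / 2 + (if k < K then C else 0))"
      using K assms(3) e by (intro sum_mono) (auto simp: not_less add_increasing less_imp_le)
    also have "\<dots> = real n * (\<epsilon> / 2) + real K * C"
    proof -
      have "(\<Sum>k<n. if k < K then C else 0) = (\<Sum>k\<in>{..<n} \<inter> {k. k < K}. C)"
        by (subst sum.inter_restrict) auto
      also have "{..<n} \<inter> {k. k < K} = {..<K}" using n by auto
      finally show ?thesis by (simp add: sum.distrib)
    qed
    also have "real K * C < real n * (\<epsilon> / 2)"
    proof -
      have "2 * real K * C < real K' * \<epsilon>" using K' e by (simp add: field_simps)
      also have "\<dots> \<le> real n * \<epsilon>" using n e by (intro mult_right_mono) auto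
      finally show ?thesis by simp
    qed
    finally have "(\<Sum>k<n. u k) < real n * (\<epsilon> / 2) + real n * (\<epsilon> / 2)" by simp
    also have "\<dots> = real n * \<epsilon>" by (simp only: distrib_left[symmetric] field_sum_of_halves)
    finally have "(\<Sum>k<n. u k) < real n * \<epsilon>" .
    then have "(\<Sum>k<n. u k) / real n < \<epsilon>" using n by (simp add: pos_divide_less_eq mult.commute)
    moreover have "0 \<le> (\<Sum>k<n. u k) / real n" using assms(2) by (simp add: sum_nonneg)
    ultimately show "norm ((\<Sum>k<n. u k) / real n - 0) < \<epsilon>" by simp
  qed
qed

text \<open>Estimates for densities arise by division by \<open>x\<close> and say nothing at 0;
  changing \<open>F\<close> at this one point does not affect the integral.\<close>

lemma integral_le_off_0:
  fixes F G :: "real \<Rightarrow> real"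
  assumes F: "F integrable_on {0..b}" and G: "G integrable_on {0..b}"
    and le: "\<And>x. 0 < x \<Longrightarrow> x \<le> b \<Longrightarrow> F x \<le> G x"
  shows "integral {0..b} F \<le> integral {0..b} G"
proof -
  let ?F = "\<lambda>x. if x = 0 then G 0 else F x"
  have "integral {0..b} F = integral {0..b} ?F"
    by (rule integral_spike[of "{0}"]) auto
  also have "\<dots> \<le> integral {0..b} G"
    by (rule integral_le[OF integrable_spike[OF F, of "{0}"] G]) (use le in auto)
  finally show ?thesis .
qed

lemma has_integral_ln_affine:
  fixes a :: real
  assumes "0 \<le> a"
  shows "((\<lambda>x. a / (1 + a * x)) has_integral ln (1 + a)) {0..1}"
proof -
  have "((\<lambda>x. a / (1 + a * x)) has_integral ln (1 + a * 1) - ln (1 + a * 0)) {0..1}"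
  proof (rule fundamental_theorem_of_calculus)
    fix x :: real assume "x \<in> {0..1}"
    then have "0 < 1 + a * x" using assms by (auto intro: add_pos_nonneg)
    then have "((\<lambda>x. ln (1 + a * x)) has_real_derivative a / (1 + a * x)) (at x within {0..1})"
      by (auto intro!: derivative_eq_intros)
    then show "((\<lambda>x. ln (1 + a * x)) has_vector_derivative a / (1 + a * x)) (at x within {0..1})"
      by (simp add: has_real_derivative_iff_has_vector_derivative)
  qed simp
  then show ?thesis by simp
qed

lemma has_integral_inverse_ln:
  assumes "0 < a" "a \<le> b"
  shows "((\<lambda>x. 1 / x) has_integral ln (b / a)) {a..b::real}"
proof -
  have "((\<lambda>x. 1 / x) has_integral ln b - ln a) {a..b}"
  proof (rule fundamental_theorem_of_calculus[OF assms(2)])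
    fix x assume "x \<in> {a..b}"
    then have "(ln has_real_derivative 1 / x) (at x within {a..b})"
      using assms by (auto intro!: derivative_eq_intros)
    then show "(ln has_vector_derivative 1 / x) (at x within {a..b})"
      by (simp add: has_real_derivative_iff_has_vector_derivative)
  qed
  then show ?thesis using assms by (simp add: ln_div)
qed

text \<open>\<open>h n\<close> models the \<open>n\<close>-th Lebesgue transfer iterate of a density
  and \<open>x * h n x\<close> the iterate of \<open>T\<close>. In \<open>upper\<close> and
  \<open>lower\<close> the indifferent branch is kept exactly; the other branches land in
  \<open>{1 / (1 + l)..1}\<close>, where a monotone function lies between its values at the two
  ends.\<close>

locale renewal_density =
  fixes h :: "nat \<Rightarrow> real \<Rightarrow> real" and l c :: real
  assumes l: "1 \<le> l"
    and cont: "continuous_on {0..1} (h n)"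
    and int: "integral {0..1} (h n) = c"
    and mono: "0 < x \<Longrightarrow> x \<le> y \<Longrightarrow> y \<le> 1 \<Longrightarrow> x * h n x \<le> y * h n y"
    and nonneg: "0 \<le> x \<Longrightarrow> x \<le> 1 \<Longrightarrow> 0 \<le> h n x"
    and upper: "0 < x \<Longrightarrow> x \<le> 1 \<Longrightarrow> x * h (Suc n) x
      \<le> 1 / (1 + l * x) * (x / (1 + l * x) * h n (x / (1 + l * x))) + (1 - 1 / (1 + l * x)) * h n 1"
    and lower: "0 < x \<Longrightarrow> x \<le> 1 \<Longrightarrow>
      1 / (1 + l * x) * (x / (1 + l * x) * h n (x / (1 + l * x)))
        + (1 - 1 / (1 + l * x)) * (1 / (1 + l) * h n (1 / (1 + l))) \<le> x * h (Suc n) x"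
begin

section \<open>Pointwise bounds along the indifferent branch\<close>

lemma affine_pos: "0 < 1 + real j * l"
  using l by (intro add_pos_nonneg) auto

definition v where "v n x = x * h n x"
definition u where "u n = h n 1"
definition m where "m n = v n (1 / (1 + l))"

lemma v_le_u: "0 < x \<Longrightarrow> x \<le> 1 \<Longrightarrow> v n x \<le> u n"
  using mono[of x 1 n] by (simp add: v_def u_def)

lemma v_nonneg: "0 < x \<Longrightarrow> x \<le> 1 \<Longrightarrow> 0 \<le> v n x"
  using nonneg by (simp add: v_def)

lemma u_nonneg: "0 \<le> u n" unfolding u_def using nonneg by simp

lemma v_upper: "0 < x \<Longrightarrow> x \<le> 1 \<Longrightarrow>
  v (Suc n) x \<le> 1 / (1 + l * x) * v n (x / (1 + l * x)) + (1 - 1 / (1 + l * x)) * u n"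
  unfolding v_def u_def by (rule upper)

lemma v_lower: "0 < x \<Longrightarrow> x \<le> 1 \<Longrightarrow>
  1 / (1 + l * x) * v n (x / (1 + l * x)) + (1 - 1 / (1 + l * x)) * m n \<le> v (Suc n) x"
  unfolding v_def m_def by (rule lower)

lemma branch_in:
  assumes "0 < x" "x \<le> 1"
  shows "0 < 1 + l * x" "0 < x / (1 + l * x)" "x / (1 + l * x) \<le> x" "x / (1 + l * x) \<le> 1"
    "1 / (1 + l * x) \<le> 1" "0 < 1 / (1 + l * x)" "1 - 1 / (1 + l * x) \<le> l * x"
proof -
  have lx: "0 < l * x" using assms l by simp
  then show p: "0 < 1 + l * x" by simp
  then show "0 < x / (1 + l * x)" using assms by simp
  show le: "x / (1 + l * x) \<le> x" using lx p assms mult_nonneg_nonneg[of "l * x" x] by (simp add: divide_le_eq algebra_simps)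
  then show "x / (1 + l * x) \<le> 1" using assms by simp
  show "1 / (1 + l * x) \<le> 1" "0 < 1 / (1 + l * x)" using lx p by auto
  have "1 - 1 / (1 + l * x) = l * x / (1 + l * x)" using p by (simp add: field_simps)
  also have "\<dots> \<le> l * x" using lx p mult_nonneg_nonneg[of "l * x" "l * x"] by (simp add: divide_le_eq algebra_simps)
  finally show "1 - 1 / (1 + l * x) \<le> l * x" .
qed

text \<open>At \<open>x = 1\<close> the indifferent branch hits exactly \<open>1 / (1 + l)\<close>,
  so the upper recursion reads \<open>(1 + l) * u (Suc n) \<le> m n + l * u n\<close>. Thus
  \<open>m n\<close> falls short of \<open>u n\<close> by at most a multiple of the decrement of
  \<open>u\<close>, and decrements are summable.\<close>

lemma u_Suc_le: "u (Suc n) \<le> u n"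
  and m_lower: "u n - (1 + l) * (u n - u (Suc n)) \<le> m n"
proof -
  have le: "u (Suc n) \<le> 1 / (1 + l) * m n + (1 - 1 / (1 + l)) * u n"
    using v_upper[of 1 n] unfolding m_def by (simp add: v_def u_def)
  have "(1 + l) * u (Suc n) \<le> (1 + l) * (1 / (1 + l) * m n + (1 - 1 / (1 + l)) * u n)"
    using le l by (intro mult_left_mono) auto
  also have "\<dots> = ((1 + l) * (1 / (1 + l))) * m n + ((1 + l) - (1 + l) * (1 / (1 + l))) * u n"
    by (simp only: algebra_simps)
  also have "\<dots> = m n + l * u n" using l by simp
  finally have *: "(1 + l) * u (Suc n) \<le> m n + l * u n" .
  then show "u n - (1 + l) * (u n - u (Suc n)) \<le> m n" by (simp add: algebra_simps)
  have "m n \<le> u n" unfolding m_def using l by (intro v_le_u) auto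
  then have "(1 + l) * u (Suc n) \<le> (1 + l) * u n" using * by (simp add: algebra_simps)
  then show "u (Suc n) \<le> u n" using l by simp
qed

lemma u_decreasing: "i \<le> j \<Longrightarrow> u j \<le> u i"
  using u_Suc_le lift_Suc_antimono_le by blast

text \<open>In each step the other branches add at most \<open>l * x * u k\<close>, while the
  indifferent one only moves \<open>x\<close> to the left. The linear dependence on \<open>x\<close>
  gives a bound for \<open>h n\<close> up to 0.\<close>

lemma v_le_growth:
  "0 < x \<Longrightarrow> x \<le> 1 \<Longrightarrow> v n x \<le> v 0 x + l * x * (\<Sum>k<n. u k)"
proof (induction n arbitrary: x)
  case (Suc n)
  note b = branch_in[OF Suc.prems]
  let ?y = "x / (1 + l * x)" and ?w = "1 / (1 + l * x)"
  have s: "0 \<le> (\<Sum>k<n. u k)" using u_nonneg by (simp add: sum_nonneg)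
  have "v (Suc n) x \<le> ?w * v n ?y + (1 - ?w) * u n" by (rule v_upper[OF Suc.prems])
  also have "\<dots> \<le> 1 * v n ?y + l * x * u n"
    using b v_nonneg u_nonneg by (intro add_mono mult_right_mono) auto
  also have "\<dots> \<le> v 0 ?y + l * ?y * (\<Sum>k<n. u k) + l * x * u n"
    using Suc.IH[of ?y] b by simp
  also have "\<dots> \<le> v 0 x + l * x * (\<Sum>k<n. u k) + l * x * u n"
    using b s l mono[of ?y x 0] Suc.prems unfolding v_def
    by (intro add_mono mult_right_mono mult_left_mono) auto
  finally show ?case by (simp add: algebra_simps)
qed simp

text \<open>The \<open>j\<close>-th iterate of \<open>x / (1 + l * x)\<close> is
  \<open>x / (1 + j * l * x)\<close>, and the weights collected on the way multiply to
  \<open>w x j\<close>: the probability of staying on the indifferent branch for \<open>j\<close>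
  steps.\<close>

definition w where "w x j = 1 / (1 + real j * l * x)"

lemma w_branch:
  assumes "0 < x" "x \<le> 1"
  shows "1 / (1 + l * x) * w (x / (1 + l * x)) j = w x (Suc j)"
proof -
  have "0 < 1 + l * x" using branch_in[OF assms] by simp
  moreover have "0 < 1 + (l * x + real j * (l * x))"
    using assms l by (auto intro!: add_pos_nonneg add_nonneg_nonneg mult_nonneg_nonneg)
  ultimately show ?thesis unfolding w_def
    by (simp add: field_simps)
qed

text \<open>Decomposition by the first departure from the indifferent branch: leaving after exactly
  \<open>j\<close> steps has probability \<open>w x j - w x (Suc j)\<close> and then yields at least
  \<open>m (n - Suc j)\<close>.\<close>

lemma v_ge_renewal:
  "0 < x \<Longrightarrow> x \<le> 1 \<Longrightarrow> (\<Sum>j<n. (w x j - w x (Suc j)) * m (n - Suc j)) \<le> v n x"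
proof (induction n arbitrary: x)
  case (Suc n)
  note b = branch_in[OF Suc.prems]
  let ?y = "x / (1 + l * x)" and ?w = "1 / (1 + l * x)"
  have "(\<Sum>j<Suc n. (w x j - w x (Suc j)) * m (Suc n - Suc j))
    = (1 - ?w) * m n + (\<Sum>j<n. ?w * ((w ?y j - w ?y (Suc j)) * m (n - Suc j)))"
    unfolding sum.lessThan_Suc_shift mult.assoc[symmetric] right_diff_distrib w_branch[OF Suc.prems]
    by (simp add: w_def)
  also have "\<dots> = ?w * (\<Sum>j<n. (w ?y j - w ?y (Suc j)) * m (n - Suc j)) + (1 - ?w) * m n"
    by (simp add: sum_distrib_left)
  also have "\<dots> \<le> ?w * v n ?y + (1 - ?w) * m n"
    using Suc.IH[of ?y] b by (intro add_right_mono mult_left_mono) auto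
  also have "\<dots> \<le> v (Suc n) x" by (rule v_lower[OF Suc.prems])
  finally show ?case .
qed (simp add: v_nonneg)

text \<open>The integral of \<open>(w x j - w x (Suc j)) / x\<close> over the unit interval.\<close>

definition \<delta> where "\<delta> j = ln (1 + real (Suc j) * l) - ln (1 + real j * l)"

section \<open>Conservation of mass and the logarithmic decay rate\<close>

lemma \<delta>_nonneg: "0 \<le> \<delta> j"
proof -
  note affine_pos[of j]
  moreover have "1 + real j * l \<le> 1 + real (Suc j) * l" using l by (simp add: algebra_simps)
  ultimately show ?thesis unfolding \<delta>_def by simp
qed

lemma \<delta>_le: "\<delta> j \<le> l / (1 + real j * l)"
proof -
  note p = affine_pos[of j]
  note q = affine_pos[of "Suc j"]
  have "\<delta> j = ln ((1 + real (Suc j) * l) / (1 + real j * l))"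
    unfolding \<delta>_def using p q by (simp add: ln_div)
  also have "(1 + real (Suc j) * l) / (1 + real j * l) = 1 + l / (1 + real j * l)"
    using p by (simp add: field_simps)
  also have "ln \<dots> \<le> l / (1 + real j * l)"
    using p l by (intro ln_add_one_self_le_self) auto
  finally show ?thesis .
qed

lemma \<delta>_le_l: "\<delta> j \<le> l"
proof -
  have "l / (1 + real j * l) \<le> l / 1" using l affine_pos[of j] by (intro divide_left_mono) auto
  then show ?thesis using \<delta>_le[of j] by simp
qed

lemma \<delta>_tendsto_0: "\<delta> \<longlonglongrightarrow> 0"
proof (rule tendsto_sandwich[of "\<lambda>_. 0" \<delta> sequentially "\<lambda>j. l / (1 + real j * l)"])
  have "filterlim (\<lambda>j. 1 + real j * l) at_top sequentially"
    using l by (intro filterlim_tendsto_add_at_top[OF tendsto_const]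
      filterlim_at_top_mult_tendsto_pos[OF tendsto_const] filterlim_real_sequentially) auto
  then show "(\<lambda>j. l / (1 + real j * l)) \<longlonglongrightarrow> 0"
    by (rule tendsto_divide_0[OF tendsto_const filterlim_at_top_imp_at_infinity])
qed (auto simp: \<delta>_nonneg \<delta>_le)

lemma sum_\<delta>: "(\<Sum>j<n. \<delta> j) = ln (1 + real n * l)"
  unfolding \<delta>_def by (subst sum_lessThan_telescope) simp

text \<open>The renewal bound divided by \<open>x\<close> is integrated against the conserved mass
  \<open>c\<close> of \<open>h n\<close>.\<close>

lemma mass_lower: "(\<Sum>j<n. \<delta> j * m (n - Suc j)) \<le> c"
proof -
  \<comment> \<open>This is \<open>(w x j - w x (Suc j)) / x\<close>. Since
    \<open>w x j / x = 1 / x - j * l / (1 + j * l * x)\<close>, the singular parts cancel, which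
    leaves a function continuous up to 0.\<close>
  define \<kappa> where "\<kappa> j x = (real (Suc j) * l) / (1 + (real (Suc j) * l) * x) - (real j * l) / (1 + (real j * l) * x)"
    for j x
  have \<kappa>: "(\<kappa> j has_integral \<delta> j) {0..1}" for j
    unfolding \<kappa>_def[abs_def] \<delta>_def using l by (intro has_integral_diff has_integral_ln_affine) auto
  have x\<kappa>: "w x j - w x (Suc j) = x * \<kappa> j x" if "0 < x" for x j
  proof -
    have "0 < 1 + real i * l * x" for i :: nat using that l by (auto intro!: add_pos_nonneg)
    from this[of j] this[of "Suc j"] show ?thesis
      unfolding w_def \<kappa>_def by (simp add: divide_simps) (simp add: algebra_simps)
  qed
  have int': "((\<lambda>x. \<Sum>j<n. \<kappa> j x * m (n - Suc j)) has_integral (\<Sum>j<n. \<delta> j * m (n - Suc j))) {0..1}"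
    by (intro has_integral_sum has_integral_mult_left \<kappa>) auto
  then have "(\<Sum>j<n. \<delta> j * m (n - Suc j)) = integral {0..1} (\<lambda>x. \<Sum>j<n. \<kappa> j x * m (n - Suc j))"
    by (simp add: integral_unique)
  also have "\<dots> \<le> integral {0..1} (h n)"
  proof (rule integral_le_off_0)
    show "(\<lambda>x. \<Sum>j<n. \<kappa> j x * m (n - Suc j)) integrable_on {0..1}" using int' by blast
    show "h n integrable_on {0..1}" using cont by (rule integrable_continuous_interval)
    fix x :: real assume x: "0 < x" "x \<le> 1"
    have "x * (\<Sum>j<n. \<kappa> j x * m (n - Suc j)) = (\<Sum>j<n. (w x j - w x (Suc j)) * m (n - Suc j))"
      by (simp add: x\<kappa>[OF x(1)] sum_distrib_left mult.assoc)
    also have "\<dots> \<le> x * h n x" using v_ge_renewal[OF x] unfolding v_def .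
    finally show "(\<Sum>j<n. \<kappa> j x * m (n - Suc j)) \<le> h n x" using x by simp
  qed
  finally show ?thesis using int by simp
qed

text \<open>Up to the factor \<open>1 + l\<close>, the error made by replacing every
  \<open>m k\<close> in \<open>mass_lower\<close> by \<open>u n\<close>. It is a convolution of a
  null sequence with a summable one.\<close>

definition E where "E n = (\<Sum>k<n. \<delta> (n - Suc k) * (u k - u (Suc k)))"

text \<open>As \<open>u\<close> decreases, each \<open>m (n - Suc j)\<close> is at least
  \<open>u n\<close> minus a multiple of a decrement, and the coefficients \<open>\<delta> j\<close>
  sum to the logarithm.\<close>

lemma u_ln_upper: "u n * ln (1 + real n * l) \<le> c + (1 + l) * E n"
proof -
  have "u n * ln (1 + real n * l) - (1 + l) * E n
     = (\<Sum>j<n. \<delta> j * u n) - (1 + l) * (\<Sum>j<n. \<delta> j * (u (n - Suc j) - u (Suc (n - Suc j))))"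
    unfolding E_def sum_\<delta>[symmetric] sum.nat_diff_reindex[of "\<lambda>j. \<delta> j * (u (n - Suc j) - u (Suc (n - Suc j)))" n, symmetric]
    by (simp add: sum_distrib_left mult.commute)
  also have "\<dots> = (\<Sum>j<n. \<delta> j * (u n - (1 + l) * (u (n - Suc j) - u (Suc (n - Suc j)))))"
    by (simp add: sum_distrib_left sum_subtractf[symmetric] algebra_simps)
  also have "\<dots> \<le> (\<Sum>j<n. \<delta> j * m (n - Suc j))"
  proof (intro sum_mono mult_left_mono \<delta>_nonneg)
    fix j
    show "u n - (1 + l) * (u (n - Suc j) - u (Suc (n - Suc j))) \<le> m (n - Suc j)"
      using m_lower[of "n - Suc j"] u_decreasing[of "n - Suc j" n] by simp
  qed
  also have "\<dots> \<le> c" by (rule mass_lower)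
  finally show ?thesis by simp
qed

lemma sum_decrements: "(\<Sum>k<n. u k - u (Suc k)) = u 0 - u n"
  by (induction n) auto

lemma summable_decrements: "summable (\<lambda>k. u k - u (Suc k))"
proof (rule bounded_imp_summable)
  show "0 \<le> u k - u (Suc k)" for k using u_Suc_le by simp
  show "(\<Sum>k\<le>n. u k - u (Suc k)) \<le> u 0" for n
    unfolding lessThan_Suc_atMost[symmetric] sum_decrements using u_nonneg by simp
qed

lemma E_tendsto_0: "E \<longlonglongrightarrow> 0"
  unfolding E_def[abs_def]
  by (rule convolution_tendsto_0[OF summable_decrements _ \<delta>_nonneg \<delta>_le_l \<delta>_tendsto_0]) (simp add: u_Suc_le)

lemma ln_affine_at_top: "filterlim (\<lambda>n. ln (1 + real n * l)) at_top sequentially"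
  using l by (intro filterlim_compose[OF ln_at_top] filterlim_tendsto_add_at_top[OF tendsto_const]
      filterlim_at_top_mult_tendsto_pos[OF tendsto_const] filterlim_real_sequentially) auto

text \<open>A crude consequence of the upper bound, wanted for the Cesaro means of \<open>u\<close>
  in the lower bound.\<close>

lemma u_tendsto_0: "u \<longlonglongrightarrow> 0"
proof (rule tendsto_sandwich[of "\<lambda>_. 0" u sequentially "\<lambda>n. (c + (1 + l) * E n) / ln (1 + real n * l)"])
  show "(\<lambda>n. (c + (1 + l) * E n) / ln (1 + real n * l)) \<longlonglongrightarrow> 0"
    using ln_affine_at_top E_tendsto_0
    by (auto intro!: tendsto_divide_0 filterlim_at_top_imp_at_infinity tendsto_intros)
  show "\<forall>\<^sub>F n in sequentially. u n \<le> (c + (1 + l) * E n) / ln (1 + real n * l)"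
    using filterlim_at_top_dense[THEN iffD1, OF ln_affine_at_top, rule_format, of 0]
    by eventually_elim (use u_ln_upper in \<open>simp add: field_simps\<close>)
qed (auto simp: u_nonneg)

text \<open>The mass is cut at \<open>1 / n\<close>. To the right,
  \<open>h n x \<le> u n / x\<close> integrates to \<open>u n * ln n\<close>; to the left,
  \<open>v_le_growth\<close> bounds \<open>h n\<close> by a constant plus a partial sum of
  \<open>u\<close>, and the length \<open>1 / n\<close> turns this sum into a Cesaro mean.\<close>

lemma u_ln_lower:
  assumes M: "\<And>x. x \<in> {0..1} \<Longrightarrow> h 0 x \<le> M" and n: "1 \<le> n"
  shows "c - (M / n + l * ((\<Sum>k<n. u k) / n)) \<le> u n * ln n"
proof -
  define a where "a = 1 / real n"
  have a: "0 < a" "a \<le> 1" using n by (auto simp: a_def)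
  have i: "h n integrable_on {0..1}" using cont by (rule integrable_continuous_interval)
  have "c = integral {0..a} (h n) + integral {a..1} (h n)"
    using Henstock_Kurzweil_Integration.integral_combine[OF _ _ i, of a] a int by simp
  moreover have "integral {0..a} (h n) \<le> integral {0..a} (\<lambda>x. M + l * (\<Sum>k<n. u k))"
  proof (rule integral_le_off_0)
    show "h n integrable_on {0..a}" using a by (intro integrable_on_subinterval[OF i]) auto
    fix x assume x: "0 < x" "x \<le> a"
    then have "x * h n x \<le> x * (h 0 x + l * (\<Sum>k<n. u k))"
      using v_le_growth[of x n] a unfolding v_def by (simp add: algebra_simps)
    then show "h n x \<le> M + l * (\<Sum>k<n. u k)" using x a M[of x] by auto
  qed auto
  moreover have "integral {a..1} (h n) \<le> integral {a..1} (\<lambda>x. u n * (1 / x))"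
  proof (rule integral_le)
    show "h n integrable_on {a..1}" using a by (intro integrable_on_subinterval[OF i]) auto
    show "(\<lambda>x. u n * (1 / x)) integrable_on {a..1}"
      using has_integral_inverse_ln[OF a] by (intro integrable_on_mult_right) auto
    fix x assume "x \<in> {a..1}"
    then show "h n x \<le> u n * (1 / x)" using v_le_u[of x n] a by (simp add: v_def field_simps)
  qed
  moreover have "integral {a..1} (\<lambda>x. u n * (1 / x)) = u n * ln n"
    using has_integral_mult_right[OF has_integral_inverse_ln[OF a], of "u n"]
    by (simp add: integral_unique a_def)
  moreover have "integral {0..a} (\<lambda>x. M + l * (\<Sum>k<n. u k)) = M / n + l * ((\<Sum>k<n. u k) / n)"
    using a by (simp add: a_def add_divide_distrib)
  ultimately show ?thesis by linarith
qed

lemma u_ln_tendsto: "(\<lambda>n. u n * ln n) \<longlonglongrightarrow> c"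
proof -
  obtain M where M: "\<And>x. x \<in> {0..1} \<Longrightarrow> h 0 x \<le> M"
  proof -
    obtain y where "\<forall>x\<in>{0..1}. h 0 x \<le> h 0 y"
      using continuous_attains_sup[of "{0..1::real}" "h 0"] cont[of 0] by auto
    then show ?thesis using that by blast
  qed
  show ?thesis
  proof (rule tendsto_sandwich)
    show "(\<lambda>n. c - (M / n + l * ((\<Sum>k<n. u k) / n))) \<longlonglongrightarrow> c"
      using tendsto_diff[OF tendsto_const[of c], OF tendsto_add_zero[OF lim_const_over_n[of M]
        tendsto_mult_right_zero[OF cesaro_null[OF u_tendsto_0 u_nonneg u_decreasing[of 0]], of l]]]
      by simp
    show "(\<lambda>n. c + (1 + l) * E n) \<longlonglongrightarrow> c"
      using tendsto_add[OF tendsto_const[of c] tendsto_mult_right_zero[OF E_tendsto_0, of "1 + l"]] by simp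
    show "\<forall>\<^sub>F n in sequentially. c - (M / n + l * ((\<Sum>k<n. u k) / n)) \<le> u n * ln n"
      using eventually_ge_at_top[of 1] by eventually_elim (rule u_ln_lower[OF M])
    show "\<forall>\<^sub>F n in sequentially. u n * ln n \<le> c + (1 + l) * E n"
      using eventually_ge_at_top[of 1]
    proof eventually_elim
      case (elim n)
      have "real n * 1 \<le> real n * l" using l by (intro mult_left_mono) auto
      then have "real n \<le> 1 + real n * l" by simp
      then have "ln (real n) \<le> ln (1 + real n * l)" using elim affine_pos[of n] by (subst ln_le_cancel_iff) auto
      then have "u n * ln n \<le> u n * ln (1 + real n * l)" by (intro mult_left_mono u_nonneg)
      then show ?case using u_ln_upper[of n] by linarith
    qed
  qed
qed

lemma tendsto_shift_ln:
  assumes "(\<lambda>n. a n * ln n) \<longlonglongrightarrow> c"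
  shows "(\<lambda>n. a (Suc n) * ln n) \<longlonglongrightarrow> c"
proof -
  have "(\<lambda>n. ln (real n) / ln (real (Suc n))) \<longlonglongrightarrow> 1"
    by real_asymp
  from tendsto_mult[OF LIMSEQ_Suc[OF assms] this]
  have "(\<lambda>n. a (Suc n) * ln (Suc n) * (ln (real n) / ln (real (Suc n)))) \<longlonglongrightarrow> c" by simp
  moreover have "\<forall>\<^sub>F n in sequentially. a (Suc n) * ln (Suc n) * (ln (real n) / ln (real (Suc n))) = a (Suc n) * ln n"
    using eventually_ge_at_top[of 1] by eventually_elim auto
  ultimately show ?thesis by (rule Lim_transform_eventually)
qed

text \<open>The points are the orbit of 1 under the indifferent branch. The upper recursion, solved
  for the value at the next orbit point, bounds it below by quantities whose limits are already
  known; the upper bound is \<open>u n\<close>.\<close>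

lemma v_ln_tendsto: "(\<lambda>n. v n (1 / (1 + real j * l)) * ln n) \<longlonglongrightarrow> c"
proof (induction j)
  case 0
  then show ?case using u_ln_tendsto by (simp add: v_def u_def)
next
  case (Suc j)
  define z where "z = 1 / (1 + real j * l)"
  note p = affine_pos[of j]
  have z: "0 < z" "z \<le> 1" unfolding z_def using p l by auto
  note b = branch_in[OF z]
  have "1 + l * z = (1 + real (Suc j) * l) * z" unfolding z_def using p by (simp add: field_simps)
  then have z': "z / (1 + l * z) = 1 / (1 + real (Suc j) * l)" using z by simp
  define \<omega> where "\<omega> = 1 / (1 + l * z)"
  have \<omega>: "0 < \<omega>" "\<omega> \<le> 1" using b by (auto simp: \<omega>_def)
  show ?case unfolding z'[symmetric]
  proof (rule tendsto_sandwich)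
    have "(\<lambda>n. (v (Suc n) z * ln n - (1 - \<omega>) * (u n * ln n)) / \<omega>) \<longlonglongrightarrow> (c - (1 - \<omega>) * c) / \<omega>"
      using \<omega> Suc.IH unfolding z_def[symmetric]
      by (intro tendsto_divide tendsto_diff tendsto_mult_left tendsto_shift_ln u_ln_tendsto tendsto_const) auto
    then show "(\<lambda>n. (v (Suc n) z * ln n - (1 - \<omega>) * (u n * ln n)) / \<omega>) \<longlonglongrightarrow> c"
      using \<omega> by (simp add: field_simps)
    show "\<forall>\<^sub>F n in sequentially. (v (Suc n) z * ln n - (1 - \<omega>) * (u n * ln n)) / \<omega> \<le> v n (z / (1 + l * z)) * ln n"
      using eventually_ge_at_top[of 1]
    proof eventually_elim
      case (elim n)
      have "v (Suc n) z * ln n \<le> (\<omega> * v n (z / (1 + l * z)) + (1 - \<omega>) * u n) * ln n"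
        using v_upper[OF z, of n] elim unfolding \<omega>_def by (intro mult_right_mono) auto
      then show ?case using \<omega> by (simp add: field_simps)
    qed
    show "\<forall>\<^sub>F n in sequentially. v n (z / (1 + l * z)) * ln n \<le> u n * ln n"
      using eventually_ge_at_top[of 1]
      by eventually_elim (use v_le_u b in \<open>auto intro!: mult_right_mono\<close>)
  qed (rule u_ln_tendsto)
qed

text \<open>On the interval, \<open>x * h n x\<close> lies between \<open>u n\<close> and its value
  at an orbit point left of \<open>\<alpha>\<close>, and after multiplication by \<open>ln n\<close>
  both converge to \<open>c\<close>.\<close>

theorem integral_ln_tendsto:
  assumes "0 < \<alpha>" "\<alpha> \<le> \<beta>" "\<beta> \<le> 1"
  shows "(\<lambda>n. ln n * integral {\<alpha>..\<beta>} (h n)) \<longlonglongrightarrow> c * ln (\<beta> / \<alpha>)"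
proof -
  \<comment> \<open>Since \<open>l \<ge> 1\<close>, this \<open>j\<close> puts the orbit point
    \<open>1 / (1 + j * l)\<close> below \<open>\<alpha>\<close>.\<close>
  obtain j where j: "1 / \<alpha> < real j" using reals_Archimedean2 by blast
  have "real j * 1 \<le> real j * l" using l by (intro mult_left_mono) auto
  then have j: "1 / \<alpha> < 1 + real j * l" using j by simp
  define z where "z = 1 / (1 + real j * l)"
  have p: "0 < 1 / \<alpha>" using assms by simp
  have "z \<le> 1 / (1 / \<alpha>)" unfolding z_def using j p affine_pos[of j] by (intro divide_left_mono mult_pos_pos) auto
  then have z: "0 < z" "z \<le> \<alpha>" using affine_pos[of j] assms unfolding z_def by auto
  have i: "h n integrable_on {\<alpha>..\<beta>}" for n
    using assms by (intro integrable_continuous_interval continuous_on_subset[OF cont]) auto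
  have k: "((\<lambda>x. k * (1 / x)) has_integral k * ln (\<beta> / \<alpha>)) {\<alpha>..\<beta>}" for k
    using has_integral_mult_right[OF has_integral_inverse_ln[OF assms(1,2)]] .
  have L: "v n z * ln (\<beta> / \<alpha>) \<le> integral {\<alpha>..\<beta>} (h n)" for n
  proof -
    have "integral {\<alpha>..\<beta>} (\<lambda>x. v n z * (1 / x)) \<le> integral {\<alpha>..\<beta>} (h n)"
    proof (rule integral_le)
      show "(\<lambda>x. v n z * (1 / x)) integrable_on {\<alpha>..\<beta>}" using k by blast
      fix x assume "x \<in> {\<alpha>..\<beta>}"
      then show "v n z * (1 / x) \<le> h n x" using mono[of z x n] z assms by (simp add: v_def field_simps)
    qed (rule i)
    then show ?thesis by (simp only: integral_unique[OF k])
  qed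
  have U: "integral {\<alpha>..\<beta>} (h n) \<le> u n * ln (\<beta> / \<alpha>)" for n
  proof -
    have "integral {\<alpha>..\<beta>} (h n) \<le> integral {\<alpha>..\<beta>} (\<lambda>x. u n * (1 / x))"
    proof (rule integral_le)
      show "(\<lambda>x. u n * (1 / x)) integrable_on {\<alpha>..\<beta>}" using k by blast
      fix x assume "x \<in> {\<alpha>..\<beta>}"
      then show "h n x \<le> u n * (1 / x)" using v_le_u[of x n] assms by (simp add: v_def field_simps)
    qed (rule i)
    then show ?thesis by (simp only: integral_unique[OF k])
  qed
  show ?thesis
  proof (rule tendsto_sandwich)
    show "(\<lambda>n. v n z * ln n * ln (\<beta> / \<alpha>)) \<longlonglongrightarrow> c * ln (\<beta> / \<alpha>)"
      unfolding z_def by (intro tendsto_mult_right v_ln_tendsto)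
    show "(\<lambda>n. u n * ln n * ln (\<beta> / \<alpha>)) \<longlonglongrightarrow> c * ln (\<beta> / \<alpha>)"
      by (intro tendsto_mult_right u_ln_tendsto)
    show "\<forall>\<^sub>F n in sequentially. v n z * ln n * ln (\<beta> / \<alpha>) \<le> ln n * integral {\<alpha>..\<beta>} (h n)"
      using eventually_ge_at_top[of 1]
    proof eventually_elim
      case (elim n)
      then show ?case using mult_left_mono[OF L[of n], of "ln n"] by (simp add: mult_ac)
    qed
    show "\<forall>\<^sub>F n in sequentially. ln n * integral {\<alpha>..\<beta>} (h n) \<le> u n * ln n * ln (\<beta> / \<alpha>)"
      using eventually_ge_at_top[of 1]
    proof eventually_elim
      case (elim n)
      then show ?case using mult_left_mono[OF U[of n], of "ln n"] by (simp add: mult_ac)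
    qed
  qed
qed

end

section \<open>The transfer operator with respect to Lebesgue measure\<close>

lemma brA_0 [simp]: "b \<noteq> 0 \<Longrightarrow> brA a b 0 = a"
  and brB_0 [simp]: "brB a b 0 = b"
  and brA_1_eq_brB_1: "brA a b 1 = brB a b 1"
  by (simp_all add: brA_def brB_def add.commute)

lemma continuous_on_brA: "0 < b \<Longrightarrow> continuous_on {0..1} (brA a b)"
  unfolding brA_def by (intro continuous_intros) auto

lemma one_plus_pos: "0 < b \<Longrightarrow> 0 \<le> y \<Longrightarrow> 0 < 1 + b * (y::real)"
  by (intro add_pos_nonneg) auto

lemma continuous_on_brB: "0 < b \<Longrightarrow> continuous_on {0..1} (brB a b)"
  unfolding brB_def
  by (intro continuous_intros ballI) (use one_plus_pos[of b] in \<open>simp add: order_less_imp_not_eq2\<close>)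

lemma continuous_on_dA: "0 < b \<Longrightarrow> continuous_on {0..1} (dA a b)"
  unfolding dA_def by (intro continuous_intros) auto

lemma continuous_on_dB: "0 < b \<Longrightarrow> continuous_on {0..1} (dB a b)"
  unfolding dB_def
  by (intro continuous_intros ballI) (use one_plus_pos[of b] in \<open>simp add: order_less_imp_not_eq2\<close>)

definition invA :: "real \<Rightarrow> real \<Rightarrow> real \<Rightarrow> real" where
  "invA a b x = b * (x - a) / (b - x)"

definition invB :: "real \<Rightarrow> real \<Rightarrow> real \<Rightarrow> real" where
  "invB a b x = (b - x) / (b * (x - a))"

lemma invA_brA:
  assumes "0 \<le> a" "a < b" "0 \<le> y"
  shows "invA a b (brA a b y) = y"
proof -
  have p: "0 < y + b" using assms by simp
  have "brA a b y - a = y * (b - a) / (y + b)" "b - brA a b y = b * (b - a) / (y + b)"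
    unfolding brA_def using p by (simp_all add: field_simps)
  then show ?thesis unfolding invA_def using p assms by simp
qed

lemma invB_brB:
  assumes "0 \<le> a" "a < b" "0 \<le> y"
  shows "invB a b (brB a b y) = y"
proof -
  have p: "0 < 1 + b * y" using assms by (intro one_plus_pos) auto
  have "brB a b y - a = (b - a) / (1 + b * y)" "b - brB a b y = b * y * (b - a) / (1 + b * y)"
    unfolding brB_def using p by (simp_all add: field_simps)
  then show ?thesis unfolding invB_def using p assms by simp
qed

lemma brA_range:
  assumes "0 \<le> a" "a < b" "0 \<le> y" "y \<le> 1"
  shows "a \<le> brA a b y" "brA a b y \<le> brA a b 1" "brA a b y < b"
proof -
  have "y * a \<le> y * b" using assms by (intro mult_left_mono) auto
  then show "a \<le> brA a b y" "brA a b y < b" unfolding brA_def using assms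
    by (auto simp: field_simps)
  have eq: "brA a b z = b - b * (b - a) / (z + b)" if "0 \<le> z" for z
    unfolding brA_def using assms that by (simp add: field_simps)
  have "b * (b - a) / (1 + b) \<le> b * (b - a) / (y + b)"
    using assms by (intro divide_left_mono) auto
  then show "brA a b y \<le> brA a b 1" using eq assms by simp
qed

lemma brB_range:
  assumes "0 \<le> a" "a < b" "0 \<le> y" "y \<le> 1"
  shows "a < brB a b y" "brB a b 1 \<le> brB a b y" "brB a b y \<le> b"
proof -
  have p: "0 < 1 + b * y" "0 < 1 + b" using assms one_plus_pos[of b y] by auto
  have "b * y * (b - a) \<ge> 0" using assms by auto
  then show "a < brB a b y" "brB a b y \<le> b" unfolding brB_def using assms p
    by (auto simp: field_simps)
  have eq: "brB a b z = a + (b - a) / (1 + b * z)" if "0 \<le> z" for z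
    unfolding brB_def using assms one_plus_pos[of b z] that by (simp add: field_simps)
  have "b * y \<le> b * 1" using assms by (intro mult_left_mono) auto
  then have "(b - a) / (1 + b * 1) \<le> (b - a) / (1 + b * y)"
    using assms p by (intro divide_left_mono) auto
  then show "brB a b 1 \<le> brB a b y" using eq[of 1] eq[of y] assms by simp
qed

text \<open>A continuous image of a Borel set need not be Borel in general. With a Borel left
  inverse \<open>k\<close> the image of \<open>S\<close> is the compact set \<open>g\<close> applied
  to the unit interval, intersected with the \<open>k\<close>-preimage of \<open>S\<close>.\<close>

lemma borel_image_of_unit_subset:
  fixes g k :: "real \<Rightarrow> real"
  assumes "continuous_on {0..1} g" "k \<in> borel_measurable borel" "\<And>y. y \<in> {0..1} \<Longrightarrow> k (g y) = y"
    and "S \<subseteq> {0..1}" "S \<in> sets borel"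
  shows "g ` S \<in> sets borel"
proof -
  have "g ` S = g ` {0..1} \<inter> (k -` S \<inter> space borel)"
    using assms(3,4) by (auto simp: image_iff)
  moreover have "closed (g ` {0..1})"
    using compact_continuous_image[OF assms(1)] compact_imp_closed by auto
  moreover have "k -` S \<inter> space borel \<in> sets borel"
    using assms(2,5) by (rule measurable_sets)
  ultimately show ?thesis by auto
qed

lemma absolutely_integrable_on_unit_subset:
  fixes f :: "real \<Rightarrow> real"
  assumes "continuous_on {0..1} f" "S \<subseteq> {0..1}" "S \<in> sets borel"
  shows "f absolutely_integrable_on S"
  by (rule set_integrable_subset[OF absolutely_integrable_continuous_real[OF assms(1)] _ assms(2)])
    (use assms(3) in simp)

lemma has_integral_branch_image:
  fixes f g g' :: "real \<Rightarrow> real"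
  assumes f: "continuous_on {0..1} f" and S: "S \<subseteq> {0..1}" "S \<in> sets borel"
    and g: "\<And>y. y \<in> S \<Longrightarrow> (g has_real_derivative g' y) (at y)"
    and inj: "inj_on g S" and im: "g ` S \<subseteq> {0..1}" "g ` S \<in> sets borel"
  shows "(f has_integral integral S (\<lambda>y. \<bar>g' y\<bar> * f (g y))) (g ` S)"
proof -
  have a: "f absolutely_integrable_on g ` S"
    using absolutely_integrable_on_unit_subset[OF f im] .
  then have "integral S (\<lambda>y. \<bar>g' y\<bar> * f (g y)) = integral (g ` S) f"
    using has_absolute_integral_change_of_variables_1'[of S g g' f "integral (g ` S) f"] S g inj
    by (auto intro: has_field_derivative_at_within)
  then show ?thesis using set_lebesgue_integral_eq_integral(1)[OF a] by (simp add: integrable_integral)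
qed

context hecke_partition
begin

definition P :: "(real \<Rightarrow> real) \<Rightarrow> real \<Rightarrow> real" where
  "P f y = (\<Sum>i<N. dA (r i) (r (Suc i)) y * f (brA (r i) (r (Suc i)) y)
                  + dB (r i) (r (Suc i)) y * f (brB (r i) (r (Suc i)) y))"

text \<open>This will be the full preimage of \<open>S\<close> under the map. Stated through inverse
  branches, it allows the duality with \<open>P\<close> to be proved before the map itself
  appears.\<close>

definition branch_image :: "real set \<Rightarrow> real set" where
  "branch_image S = (\<Union>i<N. brA (r i) (r (Suc i)) ` S \<union> brB (r i) (r (Suc i)) ` S)"

lemma branch_in_unit:
  assumes "i < N" "y \<in> {0..1}"
  shows "brA (r i) (r (Suc i)) y \<in> {0..1}" "brB (r i) (r (Suc i)) y \<in> {0..1}"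
  using brA_range[of "r i" "r (Suc i)" y] brB_range[of "r i" "r (Suc i)" y] r_branch[OF assms(1)] assms(2) by auto

lemma continuous_on_P_terms:
  assumes "continuous_on {0..1} f" "i < N"
  shows "continuous_on {0..1} (\<lambda>y. dA (r i) (r (Suc i)) y * f (brA (r i) (r (Suc i)) y))"
    "continuous_on {0..1} (\<lambda>y. dB (r i) (r (Suc i)) y * f (brB (r i) (r (Suc i)) y))"
proof -
  have b: "0 < r (Suc i)" using r_branch[OF assms(2)] by simp
  have im: "brA (r i) (r (Suc i)) ` {0..1} \<subseteq> {0..1}" "brB (r i) (r (Suc i)) ` {0..1} \<subseteq> {0..1}"
    using branch_in_unit[OF assms(2)] by blast+
  show "continuous_on {0..1} (\<lambda>y. dA (r i) (r (Suc i)) y * f (brA (r i) (r (Suc i)) y))"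
    by (rule continuous_on_mult[OF continuous_on_dA[OF b]
        continuous_on_compose2[OF assms(1) continuous_on_brA[OF b] im(1)]])
  show "continuous_on {0..1} (\<lambda>y. dB (r i) (r (Suc i)) y * f (brB (r i) (r (Suc i)) y))"
    by (rule continuous_on_mult[OF continuous_on_dB[OF b]
        continuous_on_compose2[OF assms(1) continuous_on_brB[OF b] im(2)]])
qed

lemma continuous_on_P: "continuous_on {0..1} f \<Longrightarrow> continuous_on {0..1} (P f)"
  unfolding P_def[abs_def] by (intro continuous_on_sum continuous_on_add continuous_on_P_terms) auto

lemma P_nonneg:
  assumes "\<And>x. x \<in> {0..1} \<Longrightarrow> 0 \<le> f x" "y \<in> {0..1}"
  shows "0 \<le> P f y"
  unfolding P_def
proof (intro sum_nonneg add_nonneg_nonneg mult_nonneg_nonneg)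
  fix i assume "i \<in> {..<N}"
  then have i: "i < N" by simp
  show "0 \<le> f (brA (r i) (r (Suc i)) y)" "0 \<le> f (brB (r i) (r (Suc i)) y)"
    using branch_in_unit[OF i assms(2)] assms(1) by auto
  show "0 \<le> dA (r i) (r (Suc i)) y" "0 \<le> dB (r i) (r (Suc i)) y"
    unfolding dA_def dB_def using r_branch[OF i] assms(2) by auto
qed

text \<open>\<open>T\<close> is \<open>P\<close> conjugated by multiplication with \<open>x\<close>;
  the weights were defined for this identity.\<close>

lemma mult_P_eq_T: "0 < y \<Longrightarrow> y * P f y = T (\<lambda>x. x * f x) y"
proof -
  assume y: "0 < y"
  have *: "y * (dA (r i) (r (Suc i)) y * z) = wA (r i) (r (Suc i)) y * (brA (r i) (r (Suc i)) y * z)"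
    "y * (dB (r i) (r (Suc i)) y * z) = wB (r i) (r (Suc i)) y * (brB (r i) (r (Suc i)) y * z)" if "i < N" for i z
    using wA_dA[of y "r i" "r (Suc i)"] wB_dB[of y "r i" "r (Suc i)"] r_branch[OF that] y
    by (simp_all add: mult.assoc[symmetric])
  show ?thesis unfolding P_def T_def sum_distrib_left distrib_left
    by (intro sum.cong refl arg_cong2[where f="(+)"] *) auto
qed

lemma unit_covered:
  assumes "x \<in> {0..1}"
  shows "\<exists>i<N. \<exists>y\<in>{0..1}. x = brA (r i) (r (Suc i)) y \<or> x = brB (r i) (r (Suc i)) y"
proof -
  have "\<exists>i<N. r i \<le> x \<and> x \<le> r (Suc i)" 
  proof -
    have "\<exists>i<n. r i \<le> x \<and> x \<le> r (Suc i)" if "0 < n" "x \<le> r n" for n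
      using that
    proof (induction n)
      case (Suc n)
      show ?case
      proof (cases "r n \<le> x")
        case True
        then show ?thesis using Suc.prems by blast
      next
        case False
        then have "0 < n" using assms r_0 by (cases n) auto
        then show ?thesis using Suc.IH False less_SucI by fastforce
      qed
    qed simp
    then show ?thesis using N_pos assms r_N by auto
  qed
  then obtain i where i: "i < N" "r i \<le> x" "x \<le> r (Suc i)" by blast
  note b = r_branch[OF i(1)]
  show ?thesis
  proof (cases "x \<le> brA (r i) (r (Suc i)) 1")
    case True
    then obtain y where "0 \<le> y" "y \<le> 1" "brA (r i) (r (Suc i)) y = x"
      using IVT'[of "brA (r i) (r (Suc i))" 0 x 1] i b continuous_on_brA[of "r (Suc i)" "r i"] by auto
    then show ?thesis using i by (intro exI[of _ i]) auto
  next
    case False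
    then obtain y where "0 \<le> y" "y \<le> 1" "brB (r i) (r (Suc i)) y = x"
      using IVT2'[of "brB (r i) (r (Suc i))" 1 x 0] i b continuous_on_brB[of "r (Suc i)" "r i"]
      by (auto simp: brA_1_eq_brB_1)
    then show ?thesis using i by (intro exI[of _ i]) auto
  qed
qed

lemma branch_images_borel:
  assumes "i < N" "S \<subseteq> {0..1}" "S \<in> sets borel"
  shows "brA (r i) (r (Suc i)) ` S \<in> sets borel" "brB (r i) (r (Suc i)) ` S \<in> sets borel"
proof -
  note b = r_branch[OF assms(1)]
  have "invA (r i) (r (Suc i)) \<in> borel_measurable borel" "invB (r i) (r (Suc i)) \<in> borel_measurable borel"
    unfolding invA_def[abs_def] invB_def[abs_def] by measurable
  note inv = this
  show "brA (r i) (r (Suc i)) ` S \<in> sets borel"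
    by (rule borel_image_of_unit_subset[OF continuous_on_brA inv(1) invA_brA assms(2,3)]) (use b in auto)
  show "brB (r i) (r (Suc i)) ` S \<in> sets borel"
    by (rule borel_image_of_unit_subset[OF continuous_on_brB inv(2) invB_brB assms(2,3)]) (use b in auto)
qed

lemma branch_image_borel:
  assumes "S \<subseteq> {0..1}" "S \<in> sets borel"
  shows "branch_image S \<in> sets borel"
  unfolding branch_image_def using branch_images_borel[OF _ assms] by auto

lemma branch_image_subset: "S \<subseteq> {0..1} \<Longrightarrow> branch_image S \<subseteq> {0..1}"
  unfolding branch_image_def
  by (intro UN_least Un_least image_subsetI) (blast intro: branch_in_unit)+

lemma branch_image_unit: "branch_image {0..1} = {0..1}"
proof
  show "branch_image {0..1} \<subseteq> {0..1}" by (rule branch_image_subset) simp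
  show "{0..1} \<subseteq> branch_image {0..1}" unfolding branch_image_def using unit_covered by blast
qed

text \<open>Change of variables on each branch. The pieces overlap in null sets: paired branches
  meet only at their common value at 1, and different cells at most in a partition point.\<close>

lemma has_integral_branch_image_P:
  assumes f: "continuous_on {0..1} f" and S: "S \<subseteq> {0..1}" "S \<in> sets borel"
  shows "(f has_integral integral S (P f)) (branch_image S)"
proof -
  define p where "p i y = dA (r i) (r (Suc i)) y * f (brA (r i) (r (Suc i)) y)" for i y
  define q where "q i y = dB (r i) (r (Suc i)) y * f (brB (r i) (r (Suc i)) y)" for i y
  have pq: "p i integrable_on S" "q i integrable_on S" if "i < N" for i
    using absolutely_integrable_on_unit_subset[OF continuous_on_P_terms(1)[OF f that] S]
      absolutely_integrable_on_unit_subset[OF continuous_on_P_terms(2)[OF f that] S]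
      set_lebesgue_integral_eq_integral(1)
    unfolding p_def[abs_def] q_def[abs_def] by auto
  have A: "(f has_integral integral S (p i)) (brA (r i) (r (Suc i)) ` S)"
    and B: "(f has_integral integral S (q i)) (brB (r i) (r (Suc i)) ` S)" if i: "i < N" for i
  proof -
    note b = r_branch[OF i]
    have "(f has_integral integral S (\<lambda>y. \<bar>dA (r i) (r (Suc i)) y\<bar> * f (brA (r i) (r (Suc i)) y))) (brA (r i) (r (Suc i)) ` S)"
    proof (rule has_integral_branch_image[OF f S])
      show "inj_on (brA (r i) (r (Suc i))) S"
        by (rule inj_on_inverseI[of _ "invA (r i) (r (Suc i))"]) (use invA_brA b S in auto)
      show "(brA (r i) (r (Suc i)) has_real_derivative dA (r i) (r (Suc i)) y) (at y)" if "y \<in> S" for y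
        using that b S by (intro brA_deriv) auto
    qed (use branch_in_unit[OF i] branch_images_borel[OF i S] S in auto)
    moreover have "\<bar>dA (r i) (r (Suc i)) y\<bar> = dA (r i) (r (Suc i)) y" for y
      unfolding dA_def using b by simp
    ultimately show "(f has_integral integral S (p i)) (brA (r i) (r (Suc i)) ` S)"
      unfolding p_def[abs_def] by simp
    have "(f has_integral integral S (\<lambda>y. \<bar>- dB (r i) (r (Suc i)) y\<bar> * f (brB (r i) (r (Suc i)) y))) (brB (r i) (r (Suc i)) ` S)"
    proof (rule has_integral_branch_image[OF f S])
      show "inj_on (brB (r i) (r (Suc i))) S"
        by (rule inj_on_inverseI[of _ "invB (r i) (r (Suc i))"]) (use invB_brB b S in auto)
      show "(brB (r i) (r (Suc i)) has_real_derivative - dB (r i) (r (Suc i)) y) (at y)" if "y \<in> S" for y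
        using that b S one_plus_pos[of "r (Suc i)" y] by (intro brB_deriv) auto
    qed (use branch_in_unit[OF i] branch_images_borel[OF i S] S in auto)
    moreover have "\<bar>- dB (r i) (r (Suc i)) y\<bar> = dB (r i) (r (Suc i)) y" for y
      unfolding dB_def using b by simp
    ultimately show "(f has_integral integral S (q i)) (brB (r i) (r (Suc i)) ` S)"
      unfolding q_def[abs_def] by simp
  qed
  have AB: "(f has_integral integral S (p i) + integral S (q i)) (brA (r i) (r (Suc i)) ` S \<union> brB (r i) (r (Suc i)) ` S)"
    if i: "i < N" for i
  proof (rule has_integral_Un[OF A[OF i] B[OF i]])
    have "brA (r i) (r (Suc i)) ` S \<inter> brB (r i) (r (Suc i)) ` S \<subseteq> {brA (r i) (r (Suc i)) 1}"
    proof
      fix x assume "x \<in> brA (r i) (r (Suc i)) ` S \<inter> brB (r i) (r (Suc i)) ` S"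
      then have "x \<le> brA (r i) (r (Suc i)) 1" "brB (r i) (r (Suc i)) 1 \<le> x"
      proof -
        from \<open>x \<in> _\<close> obtain y z where x: "x = brA (r i) (r (Suc i)) y" "y \<in> S" "x = brB (r i) (r (Suc i)) z" "z \<in> S"
          by blast
        then have "y \<in> {0..1}" "z \<in> {0..1}" using S(1) by auto
        then show "x \<le> brA (r i) (r (Suc i)) 1" "brB (r i) (r (Suc i)) 1 \<le> x"
          using brA_range(2)[of "r i" "r (Suc i)" y] brB_range(2)[of "r i" "r (Suc i)" z] r_branch[OF i]
          unfolding x(1) by (simp_all add: x(1)[symmetric] x(3)[symmetric])
      qed
      then show "x \<in> {brA (r i) (r (Suc i)) 1}" by (simp add: brA_1_eq_brB_1)
    qed
    then show "negligible (brA (r i) (r (Suc i)) ` S \<inter> brB (r i) (r (Suc i)) ` S)"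
      by (rule negligible_subset[rotated]) simp
  qed
  have range: "brA (r i) (r (Suc i)) ` S \<union> brB (r i) (r (Suc i)) ` S \<subseteq> {r i..r (Suc i)}" if "i < N" for i
  proof (intro Un_least image_subsetI)
    fix y assume "y \<in> S"
    then have y: "0 \<le> y" "y \<le> 1" using S(1) by auto
    note b = r_branch[OF that]
    show "brA (r i) (r (Suc i)) y \<in> {r i..r (Suc i)}" "brB (r i) (r (Suc i)) y \<in> {r i..r (Suc i)}"
      using brA_range[of "r i" "r (Suc i)" y] brB_range[of "r i" "r (Suc i)" y] b y by auto
  qed
  have "(f has_integral (\<Sum>i<N. integral S (p i) + integral S (q i))) (branch_image S)"
    unfolding branch_image_def
  proof (rule has_integral_UN)
    have "negligible ((brA (r i) (r (Suc i)) ` S \<union> brB (r i) (r (Suc i)) ` S)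
        \<inter> (brA (r j) (r (Suc j)) ` S \<union> brB (r j) (r (Suc j)) ` S))" if "i < N" "j < N" "i < j" for i j
    proof (rule negligible_subset[of "{r (Suc i)}"])
      have "r (Suc i) \<le> r j" using r_mono that by simp
      then show "(brA (r i) (r (Suc i)) ` S \<union> brB (r i) (r (Suc i)) ` S)
        \<inter> (brA (r j) (r (Suc j)) ` S \<union> brB (r j) (r (Suc j)) ` S) \<subseteq> {r (Suc i)}"
      proof (intro subsetI)
        fix x assume x: "x \<in> (brA (r i) (r (Suc i)) ` S \<union> brB (r i) (r (Suc i)) ` S)
          \<inter> (brA (r j) (r (Suc j)) ` S \<union> brB (r j) (r (Suc j)) ` S)"
        have "x \<in> {r i..r (Suc i)}" using x range[OF that(1)] by blast
        moreover have "x \<in> {r j..r (Suc j)}" using x range[OF that(2)] by blast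
        ultimately show "x \<in> {r (Suc i)}" using \<open>r (Suc i) \<le> r j\<close> by simp
      qed
    qed simp
    then show "pairwise (\<lambda>i j. negligible ((brA (r i) (r (Suc i)) ` S \<union> brB (r i) (r (Suc i)) ` S)
        \<inter> (brA (r j) (r (Suc j)) ` S \<union> brB (r j) (r (Suc j)) ` S))) {..<N}"
      unfolding pairwise_def by (metis Int_commute lessThan_iff linorder_neqE_nat)
  qed (use AB in auto)
  moreover have "integral S (P f) = (\<Sum>i<N. integral S (p i) + integral S (q i))"
  proof -
    have "integral S (P f) = (\<Sum>i<N. integral S (\<lambda>y. p i y + q i y))"
      unfolding P_def[abs_def] p_def[symmetric] q_def[symmetric]
      by (intro integral_sum integrable_add pq) auto
    also have "\<dots> = (\<Sum>i<N. integral S (p i) + integral S (q i))"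
      by (intro sum.cong refl integral_add pq) auto
    finally show ?thesis .
  qed
  ultimately show ?thesis by simp
qed

section \<open>Separating the indifferent branch in the averaging operator\<close>

lemma first_branch:
  assumes "0 < x"
  shows "wA (r 0) (r 1) x = 1 / (1 + l * x)" "brA (r 0) (r 1) x = x / (1 + l * x)"
proof -
  have p: "0 < r 1" using r_1 by simp
  have l: "l = 1 / r 1" using r_1(1) p by (simp add: field_simps)
  show "wA (r 0) (r 1) x = 1 / (1 + l * x)" "brA (r 0) (r 1) x = x / (1 + l * x)"
    unfolding wA_def brA_def r_0 l using p assms by (simp_all add: divide_simps add.commute)
qed

text \<open>Both families telescope, to \<open>1 / (x + 1)\<close> and
  \<open>1 - 1 / (1 + x)\<close>, since the partition runs from 0 to 1. This is the invariance of
  the density \<open>1 / x\<close>.\<close>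

lemma sum_weights:
  assumes "0 < x"
  shows "(\<Sum>i<N. wA (r i) (r (Suc i)) x + wB (r i) (r (Suc i)) x) = 1"
proof -
  have "(\<Sum>i<N. wA (r i) (r (Suc i)) x) = 1 / (x + 1)"
    unfolding wA_def using sum_lessThan_telescope[of "\<lambda>i. r i / (x + r i)" N] r_0 r_N by simp
  moreover have "(\<Sum>i<N. wB (r i) (r (Suc i)) x) = 1 - 1 / (1 + x)"
    unfolding wB_def using sum_lessThan_telescope'[of "\<lambda>i. 1 / (1 + r i * x)" N] r_0 r_N by simp
  ultimately show ?thesis by (simp add: sum.distrib add.commute)
qed

text \<open>As the weights sum to 1, a constant \<open>K\<close> can be split off, and every branch
  except the indifferent one contributes a weight times \<open>g - K\<close>. Choosing
  \<open>K\<close> as an upper or lower bound of \<open>g\<close> on the other images gives the two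
  recursions.\<close>

lemma T_eq_first_branch:
  assumes "0 < x"
  shows "\<exists>M. N = Suc M \<and> T g x = 1 / (1 + l * x) * g (x / (1 + l * x)) + (1 - 1 / (1 + l * x)) * K
    + wB (r 0) (r 1) x * (g (brB (r 0) (r 1) x) - K)
    + (\<Sum>i<M. wA (r (Suc i)) (r (Suc (Suc i))) x * (g (brA (r (Suc i)) (r (Suc (Suc i))) x) - K)
           + wB (r (Suc i)) (r (Suc (Suc i))) x * (g (brB (r (Suc i)) (r (Suc (Suc i))) x) - K))"
proof -
  obtain M where M: "N = Suc M" using N_pos by (cases N) auto
  have "T g x = K * (\<Sum>i<N. wA (r i) (r (Suc i)) x + wB (r i) (r (Suc i)) x)
     + (\<Sum>i<N. wA (r i) (r (Suc i)) x * (g (brA (r i) (r (Suc i)) x) - K)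
           + wB (r i) (r (Suc i)) x * (g (brB (r i) (r (Suc i)) x) - K))"
    unfolding T_def sum_distrib_left sum.distrib[symmetric]
    by (intro sum.cong refl) (simp add: algebra_simps)
  then show ?thesis
    using first_branch[OF assms] unfolding sum_weights[OF assms] unfolding M sum.lessThan_Suc_shift
    by (intro exI[of _ M]) (simp add: algebra_simps)
qed

lemma weights_nonneg:
  assumes "i < N" "0 < x" "x \<le> 1"
  shows "0 \<le> wA (r i) (r (Suc i)) x" "0 \<le> wB (r i) (r (Suc i)) x"
  using wB_le_wA[of "r i" "r (Suc i)" x] r_branch[OF assms(1)] assms by auto

lemma T_upper:
  assumes g: "\<And>s t. 0 < s \<Longrightarrow> s \<le> t \<Longrightarrow> t \<le> 1 \<Longrightarrow> g s \<le> g t" and x: "0 < x" "x \<le> 1"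
  shows "T g x \<le> 1 / (1 + l * x) * g (x / (1 + l * x)) + (1 - 1 / (1 + l * x)) * g 1"
proof -
  obtain M where M: "N = Suc M" and eq: "T g x = 1 / (1 + l * x) * g (x / (1 + l * x)) + (1 - 1 / (1 + l * x)) * g 1
    + wB (r 0) (r 1) x * (g (brB (r 0) (r 1) x) - g 1)
    + (\<Sum>i<M. wA (r (Suc i)) (r (Suc (Suc i))) x * (g (brA (r (Suc i)) (r (Suc (Suc i))) x) - g 1)
           + wB (r (Suc i)) (r (Suc (Suc i))) x * (g (brB (r (Suc i)) (r (Suc (Suc i))) x) - g 1))"
    using T_eq_first_branch[OF x(1), of g "g 1"] by blast
  have le: "g (brA (r i) (r (Suc i)) x) - g 1 \<le> 0" "g (brB (r i) (r (Suc i)) x) - g 1 \<le> 0" if "i < N" for i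
    using g[of "brA (r i) (r (Suc i)) x" 1] g[of "brB (r i) (r (Suc i)) x" 1] r_branch[OF that]
      brA_bounds[of "r i" "r (Suc i)" x] brB_bounds[of "r i" "r (Suc i)" x] x by auto
  have "wB (r 0) (r 1) x * (g (brB (r 0) (r 1) x) - g 1) \<le> 0"
    using le[of 0] weights_nonneg[of 0 x] N_pos x by (auto intro: mult_nonneg_nonpos)
  moreover have "(\<Sum>i<M. wA (r (Suc i)) (r (Suc (Suc i))) x * (g (brA (r (Suc i)) (r (Suc (Suc i))) x) - g 1)
           + wB (r (Suc i)) (r (Suc (Suc i))) x * (g (brB (r (Suc i)) (r (Suc (Suc i))) x) - g 1)) \<le> 0"
    using M x by (intro sum_nonpos add_nonpos_nonpos mult_nonneg_nonpos le weights_nonneg) auto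
  ultimately show ?thesis using eq by linarith
qed

lemma T_lower:
  assumes g: "\<And>s t. 0 < s \<Longrightarrow> s \<le> t \<Longrightarrow> t \<le> 1 \<Longrightarrow> g s \<le> g t" and x: "0 < x" "x \<le> 1"
  shows "1 / (1 + l * x) * g (x / (1 + l * x)) + (1 - 1 / (1 + l * x)) * g (1 / (1 + l)) \<le> T g x"
proof -
  let ?K = "g (1 / (1 + l))"
  obtain M where M: "N = Suc M" and eq: "T g x = 1 / (1 + l * x) * g (x / (1 + l * x)) + (1 - 1 / (1 + l * x)) * ?K
    + wB (r 0) (r 1) x * (g (brB (r 0) (r 1) x) - ?K)
    + (\<Sum>i<M. wA (r (Suc i)) (r (Suc (Suc i))) x * (g (brA (r (Suc i)) (r (Suc (Suc i))) x) - ?K)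
           + wB (r (Suc i)) (r (Suc (Suc i))) x * (g (brB (r (Suc i)) (r (Suc (Suc i))) x) - ?K))"
    using T_eq_first_branch[OF x(1), of g ?K] by blast
  \<comment> \<open>The common end of the images of the first pair, hence a lower bound for the
    values of all branches other than the indifferent one.\<close>
  have K: "1 / (1 + l) = brB (r 0) (r 1) 1" "0 < 1 / (1 + l)"
    using first_branch[of 1] r_1 by (auto simp: brA_1_eq_brB_1)
  have r01: "0 \<le> r 0" "r 0 < r 1" "r 1 \<le> 1" using r_branch[of 0] N_pos by auto
  have B0: "1 / (1 + l) \<le> brB (r 0) (r 1) x" "brB (r 0) (r 1) x \<le> 1" "1 / (1 + l) \<le> r 1"
    unfolding K using brB_range[of "r 0" "r 1" x] brB_range[of "r 0" "r 1" 1] r01 x by auto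
  have "0 \<le> wB (r 0) (r 1) x * (g (brB (r 0) (r 1) x) - ?K)"
    using g[OF K(2) B0(1,2)] weights_nonneg[of 0 x] N_pos x by auto
  moreover have ge: "0 \<le> g (brA (r (Suc i)) (r (Suc (Suc i))) x) - ?K"
    "0 \<le> g (brB (r (Suc i)) (r (Suc (Suc i))) x) - ?K" if "i < M" for i
  proof -
    have i: "Suc i < N" using that M by simp
    have "r 1 \<le> r (Suc i)" using r_mono[of 1 "Suc i"] i by simp
    then have "1 / (1 + l) \<le> brA (r (Suc i)) (r (Suc (Suc i))) x" "1 / (1 + l) \<le> brB (r (Suc i)) (r (Suc (Suc i))) x"
      "brA (r (Suc i)) (r (Suc (Suc i))) x \<le> 1" "brB (r (Suc i)) (r (Suc (Suc i))) x \<le> 1"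
      using B0 r_branch[OF i] brA_bounds[of "r (Suc i)" "r (Suc (Suc i))" x]
        brB_bounds[of "r (Suc i)" "r (Suc (Suc i))" x] x by auto
    then show "0 \<le> g (brA (r (Suc i)) (r (Suc (Suc i))) x) - ?K"
      "0 \<le> g (brB (r (Suc i)) (r (Suc (Suc i))) x) - ?K" using g[OF K(2)] by auto
  qed
  moreover have "0 \<le> (\<Sum>i<M. wA (r (Suc i)) (r (Suc (Suc i))) x * (g (brA (r (Suc i)) (r (Suc (Suc i))) x) - ?K)
           + wB (r (Suc i)) (r (Suc (Suc i))) x * (g (brB (r (Suc i)) (r (Suc (Suc i))) x) - ?K))"
    using M x by (intro sum_nonneg add_nonneg_nonneg mult_nonneg_nonneg ge weights_nonneg) auto
  ultimately show ?thesis using eq by linarith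
qed

text \<open>Agreement is assumed on all positive reals, beyond 1, because the derivatives at 1 are
  two-sided.\<close>

lemma incr_concave_cong:
  assumes "incr_concave g" "\<And>x. 0 < x \<Longrightarrow> g' x = g x"
  shows "incr_concave g'"
proof -
  have "(g' has_real_derivative D) (at x)" if "(g has_real_derivative D) (at x)" "0 < x" for x D
    using that(1) by (rule has_field_derivative_transform_within_open[of _ _ _ "{0<..}"]) (use that assms in auto)
  then show ?thesis using assms(1) unfolding incr_concave_def by (metis greaterThanAtMost_iff)
qed

lemma continuous_on_P_power: "continuous_on {0..1} f \<Longrightarrow> continuous_on {0..1} ((P ^^ n) f)"
  by (induction n) (auto intro: continuous_on_P)

lemma renewal_density_P:
  assumes f: "continuous_on {0..1} f" "\<And>x. x \<in> {0..1} \<Longrightarrow> 0 \<le> f x" "incr_concave (\<lambda>x. x * f x)"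
  shows "renewal_density (\<lambda>n. (P ^^ n) f) l (integral {0..1} f)"
proof -
  have conc: "incr_concave (\<lambda>x. x * (P ^^ n) f x)" for n
  proof (induction n)
    case (Suc n)
    show ?case
      by (rule incr_concave_cong[OF T_incr_concave[OF Suc]]) (simp add: mult_P_eq_T)
  qed (use f in simp)
  have nonneg: "\<forall>x\<in>{0..1}. 0 \<le> (P ^^ n) f x" for n
    by (induction n) (use f P_nonneg in auto)
  have int: "integral {0..1} ((P ^^ n) f) = integral {0..1} f" for n
  proof (induction n)
    case (Suc n)
    have "((P ^^ n) f has_integral integral {0..1} (P ((P ^^ n) f))) (branch_image {0..1})"
      by (rule has_integral_branch_image_P[OF continuous_on_P_power[OF f(1)]]) auto
    then show ?case using Suc by (simp add: branch_image_unit integral_unique)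
  qed simp
  show ?thesis
  proof
    fix n and x y :: real
    show "1 \<le> l" using r_1 by simp
    show "continuous_on {0..1} ((P ^^ n) f)" by (rule continuous_on_P_power[OF f(1)])
    show "integral {0..1} ((P ^^ n) f) = integral {0..1} f" by (rule int)
    show "x * (P ^^ n) f x \<le> y * (P ^^ n) f y" if "0 < x" "x \<le> y" "y \<le> 1"
      by (rule incr_concave_mono[OF conc that])
    show "0 \<le> (P ^^ n) f x" if "0 \<le> x" "x \<le> 1" using nonneg that by auto
    assume x: "0 < x" "x \<le> 1"
    have eq: "x * (P ^^ Suc n) f x = T (\<lambda>x. x * (P ^^ n) f x) x" using mult_P_eq_T[OF x(1)] by simp
    show "x * (P ^^ Suc n) f x \<le> 1 / (1 + l * x) * (x / (1 + l * x) * (P ^^ n) f (x / (1 + l * x)))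
        + (1 - 1 / (1 + l * x)) * (P ^^ n) f 1"
      unfolding eq using T_upper[of "\<lambda>x. x * (P ^^ n) f x", OF incr_concave_mono[OF conc] x] by simp
    show "1 / (1 + l * x) * (x / (1 + l * x) * (P ^^ n) f (x / (1 + l * x)))
        + (1 - 1 / (1 + l * x)) * (1 / (1 + l) * (P ^^ n) f (1 / (1 + l))) \<le> x * (P ^^ Suc n) f x"
      unfolding eq using T_lower[of "\<lambda>x. x * (P ^^ n) f x", OF incr_concave_mono[OF conc] x] by simp
  qed
qed

end

section \<open>Preimages under the Farey map of a partition\<close>

context hecke_partition
begin

lemma branch_in_interval:
  assumes "i < N" "y \<in> {0..1}"
  shows "r i \<le> brA (r i) (r (Suc i)) y" "brA (r i) (r (Suc i)) y < r (Suc i)"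
    "r i < brB (r i) (r (Suc i)) y" "brB (r i) (r (Suc i)) y \<le> r (Suc i)"
  using brA_range[of "r i" "r (Suc i)" y] brB_range[of "r i" "r (Suc i)" y] r_branch[OF assms(1)] assms(2) by auto

text \<open>The graph of the map as a relation. The map is given by a choice among overlapping
  pieces, so existence and uniqueness of the value are shown for this relation.\<close>

definition inverse_branch_rel :: "real \<Rightarrow> real \<Rightarrow> bool" where
  "inverse_branch_rel x y \<longleftrightarrow> y \<in> {0..1} \<and>
     (\<exists>i<N. x = brA (r i) (r (Suc i)) y \<or> x = brB (r i) (r (Suc i)) y)"

text \<open>In the mixed case the two images lie on opposite sides of the common value at 1, which
  forces both arguments to be 1.\<close>

lemma branch_inj:
  assumes "i < N" "y \<in> {0..1}" "z \<in> {0..1}"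
  shows "brA (r i) (r (Suc i)) y = brA (r i) (r (Suc i)) z \<Longrightarrow> y = z"
    "brB (r i) (r (Suc i)) y = brB (r i) (r (Suc i)) z \<Longrightarrow> y = z"
    "brA (r i) (r (Suc i)) y = brB (r i) (r (Suc i)) z \<Longrightarrow> y = z"
proof -
  note b = r_branch[OF assms(1)]
  have A: "y = z" if "brA (r i) (r (Suc i)) y = brA (r i) (r (Suc i)) z" "y \<in> {0..1}" "z \<in> {0..1}" for y z
    using invA_brA[of "r i" "r (Suc i)"] b that by (metis atLeastAtMost_iff)
  have B: "y = z" if "brB (r i) (r (Suc i)) y = brB (r i) (r (Suc i)) z" "y \<in> {0..1}" "z \<in> {0..1}" for y z
    using invB_brB[of "r i" "r (Suc i)"] b that by (metis atLeastAtMost_iff)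
  show "brA (r i) (r (Suc i)) y = brA (r i) (r (Suc i)) z \<Longrightarrow> y = z"
    "brB (r i) (r (Suc i)) y = brB (r i) (r (Suc i)) z \<Longrightarrow> y = z"
    by (rule A[OF _ assms(2,3)], assumption) (rule B[OF _ assms(2,3)], assumption)
  show "y = z" if *: "brA (r i) (r (Suc i)) y = brB (r i) (r (Suc i)) z"
  proof -
    have "brA (r i) (r (Suc i)) y = brA (r i) (r (Suc i)) 1" "brB (r i) (r (Suc i)) z = brB (r i) (r (Suc i)) 1"
      using brA_range(2)[of "r i" "r (Suc i)" y] brB_range(2)[of "r i" "r (Suc i)" z] b assms * brA_1_eq_brB_1[of "r i" "r (Suc i)"]
      by auto
    then have "y = 1" "z = 1" using A[of y 1] B[of z 1] assms by auto
    then show ?thesis by simp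
  qed
qed

text \<open>A point in two cells is their common end. It is reached from the left cell by
  \<open>brB\<close> and from the right one by \<open>brA\<close>, in both cases at argument
  0.\<close>

lemma branch_inverse_order:
  assumes "i < j" "j < N" "y \<in> {0..1}" "z \<in> {0..1}"
    and x: "x = brA (r i) (r (Suc i)) y \<or> x = brB (r i) (r (Suc i)) y"
    and x': "x = brA (r j) (r (Suc j)) z \<or> x = brB (r j) (r (Suc j)) z"
  shows "y = z"
proof -
  have i: "i < N" using assms by simp
  have le: "r (Suc i) \<le> r j" using r_mono assms by simp
  have "x \<le> r (Suc i)" "r j \<le> x"
    using x x' branch_in_interval[OF i assms(3)] branch_in_interval[OF assms(2,4)] by auto
  then have eq: "x = r (Suc i)" "x = r j" using le by auto
  have "brB (r i) (r (Suc i)) y = brB (r i) (r (Suc i)) 0"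
    using x eq(1) branch_in_interval(2)[OF i assms(3)] by auto
  then have "y = 0" using branch_inj(2)[OF i assms(3), of 0] by simp
  moreover have "brA (r j) (r (Suc j)) z = brA (r j) (r (Suc j)) 0"
    using x' eq(2) branch_in_interval(3)[OF assms(2,4)] r_branch[OF assms(2)] by auto
  then have "z = 0" using branch_inj(1)[OF assms(2,4), of 0] by simp
  ultimately show ?thesis by simp
qed

lemma inverse_branch_rel_unique:
  assumes "inverse_branch_rel x y" "inverse_branch_rel x z"
  shows "y = z"
proof -
  obtain i where i: "i < N" "x = brA (r i) (r (Suc i)) y \<or> x = brB (r i) (r (Suc i)) y" "y \<in> {0..1}"
    using assms(1) unfolding inverse_branch_rel_def by blast
  obtain j where j: "j < N" "x = brA (r j) (r (Suc j)) z \<or> x = brB (r j) (r (Suc j)) z" "z \<in> {0..1}"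
    using assms(2) unfolding inverse_branch_rel_def by blast
  consider "i < j" | "j < i" | "i = j" by linarith
  then show ?thesis
  proof cases
    case 1
    then show ?thesis using branch_inverse_order[OF _ j(1) i(3) j(3) i(2) j(2)] by simp
  next
    case 2
    then show ?thesis using branch_inverse_order[OF _ i(1) j(3) i(3) j(2) i(2)] by simp
  next
    case 3
    then show ?thesis
      using i(2) j(2)[folded 3] branch_inj[OF i(1) i(3) j(3)] branch_inj(3)[OF i(1) j(3) i(3)]
      by metis
  qed
qed

text \<open>The right-hand side has the shape of the condition inside \<open>farey\<close>: a domain
  interval with a forward branch on it.\<close>

lemma inverse_branch_rel_iff:
  "inverse_branch_rel x y \<longleftrightarrow> (\<exists>i<N.
     (x \<in> {brA (r i) (r (Suc i)) 0..brA (r i) (r (Suc i)) 1} \<and> y = invA (r i) (r (Suc i)) x) \<or>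
     (x \<in> {brB (r i) (r (Suc i)) 1..brB (r i) (r (Suc i)) 0} \<and> y = invB (r i) (r (Suc i)) x))"
  (is "_ \<longleftrightarrow> ?R")
proof
  assume "inverse_branch_rel x y"
  then obtain i where i: "i < N" "x = brA (r i) (r (Suc i)) y \<or> x = brB (r i) (r (Suc i)) y" "0 \<le> y" "y \<le> 1"
    unfolding inverse_branch_rel_def by auto
  note b = r_branch[OF i(1)]
  show ?R
    using i brA_range[of "r i" "r (Suc i)" y] brB_range[of "r i" "r (Suc i)" y] b
      invA_brA[of "r i" "r (Suc i)" y] invB_brB[of "r i" "r (Suc i)" y]
    by (intro exI[of _ i]) auto
next
  assume ?R
  then obtain i where i: "i < N" and
    "(x \<in> {brA (r i) (r (Suc i)) 0..brA (r i) (r (Suc i)) 1} \<and> y = invA (r i) (r (Suc i)) x) \<or>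
     (x \<in> {brB (r i) (r (Suc i)) 1..brB (r i) (r (Suc i)) 0} \<and> y = invB (r i) (r (Suc i)) x)"
    by blast
  then consider (A) "x \<in> {brA (r i) (r (Suc i)) 0..brA (r i) (r (Suc i)) 1}" "y = invA (r i) (r (Suc i)) x"
    | (B) "x \<in> {brB (r i) (r (Suc i)) 1..brB (r i) (r (Suc i)) 0}" "y = invB (r i) (r (Suc i)) x" by blast
  then show "inverse_branch_rel x y"
  proof cases
    case A
    then obtain z where "0 \<le> z" "z \<le> 1" "brA (r i) (r (Suc i)) z = x"
      using IVT'[of "brA (r i) (r (Suc i))" 0 x 1] r_branch[OF i] continuous_on_brA[of "r (Suc i)" "r i"] by auto
    then show ?thesis unfolding inverse_branch_rel_def
      using A invA_brA[of "r i" "r (Suc i)" z] r_branch[OF i] i by auto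
  next
    case B
    then obtain z where "0 \<le> z" "z \<le> 1" "brB (r i) (r (Suc i)) z = x"
      using IVT2'[of "brB (r i) (r (Suc i))" 1 x 0] r_branch[OF i] continuous_on_brB[of "r (Suc i)" "r i"] by auto
    then show ?thesis unfolding inverse_branch_rel_def
      using B invB_brB[of "r i" "r (Suc i)" z] r_branch[OF i] i by auto
  qed
qed

lemma inverse_branch_rel_exists: "x \<in> {0..1} \<Longrightarrow> \<exists>y. inverse_branch_rel x y"
  using unit_covered unfolding inverse_branch_rel_def by blast

end

locale hecke_partition_map = hecke_partition +
  fixes F :: "real \<Rightarrow> real"
  assumes F_rel: "x \<in> {0..1} \<Longrightarrow> inverse_branch_rel x (F x)"
begin

section \<open>Iterated preimages and duality\<close>

definition preimage :: "nat \<Rightarrow> real set \<Rightarrow> real set" where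
  "preimage n S = {x \<in> {0..1}. (F ^^ n) x \<in> S}"

lemma F_preimage:
  assumes "S \<subseteq> {0..1}"
  shows "{x \<in> {0..1}. F x \<in> S} = branch_image S"
proof (intro set_eqI iffI)
  fix x assume "x \<in> {x \<in> {0..1}. F x \<in> S}"
  then show "x \<in> branch_image S"
    using F_rel[of x] unfolding inverse_branch_rel_def branch_image_def by blast
next
  fix x assume x: "x \<in> branch_image S"
  then have "x \<in> {0..1}" using branch_image_subset[OF assms] by blast
  moreover obtain y where "y \<in> S" "inverse_branch_rel x y"
    using x assms unfolding branch_image_def inverse_branch_rel_def by blast
  ultimately show "x \<in> {x \<in> {0..1}. F x \<in> S}"
    using inverse_branch_rel_unique[OF F_rel[of x]] by auto
qed

lemma preimage_Suc: "preimage (Suc n) S = branch_image (preimage n S)"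
proof -
  have "F x \<in> {0..1}" if "x \<in> {0..1}" for x
    using F_rel[OF that] unfolding inverse_branch_rel_def by blast
  then have "preimage (Suc n) S = {x \<in> {0..1}. F x \<in> preimage n S}"
    unfolding preimage_def funpow_Suc_right by auto
  also have "\<dots> = branch_image (preimage n S)"
    by (rule F_preimage) (auto simp: preimage_def)
  finally show ?thesis .
qed

lemma preimage_subset: "preimage n S \<subseteq> {0..1}"
  unfolding preimage_def by auto

lemma preimage_borel:
  assumes "S \<in> sets borel" "S \<subseteq> {0..1}"
  shows "preimage n S \<in> sets borel"
proof (induction n)
  case 0
  have "preimage 0 S = S" using assms(2) unfolding preimage_def by auto
  then show ?case using assms by simp
qed (auto simp: preimage_Suc intro!: branch_image_borel preimage_subset)

lemma integral_preimage:
  assumes "S \<in> sets borel" "S \<subseteq> {0..1}" "continuous_on {0..1} f"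
  shows "integral (preimage n S) f = integral S ((P ^^ n) f)"
  using assms(3)
proof (induction n arbitrary: f)
  case 0
  have "preimage 0 S = S" using assms(2) unfolding preimage_def by auto
  then show ?case by simp
next
  case (Suc n)
  have "integral (preimage (Suc n) S) f = integral (preimage n S) (P f)"
    unfolding preimage_Suc
    by (rule integral_unique[OF has_integral_branch_image_P[OF Suc.prems preimage_subset preimage_borel[OF assms(1,2)]]])
  also have "\<dots> = integral S ((P ^^ n) (P f))"
    by (rule Suc.IH[OF continuous_on_P[OF Suc.prems]])
  finally show ?case by (simp only: funpow_Suc_right o_def)
qed

lemma integrable_on_preimage:
  fixes f :: "real \<Rightarrow> real"
  assumes "S \<in> sets borel" "S \<subseteq> {0..1}" "continuous_on {0..1} f"
  shows "f integrable_on preimage n S"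
  using set_lebesgue_integral_eq_integral(1)[OF absolutely_integrable_on_unit_subset[OF assms(3)
    preimage_subset preimage_borel[OF assms(1,2)]]] .

context
  fixes \<alpha> \<beta> :: real
  assumes ab: "0 < \<alpha>" "\<alpha> \<le> \<beta>" "\<beta> \<le> 1"
begin

definition L :: "(real \<Rightarrow> real) \<Rightarrow> nat \<Rightarrow> real" where
  "L f n = ln n * integral (preimage n {\<alpha>..\<beta>}) f"

lemma interval: "{\<alpha>..\<beta>} \<in> sets borel" "{\<alpha>..\<beta>} \<subseteq> {0..1}"
  using ab by auto

section \<open>From concave densities to continuous functions\<close>

lemma L_tendsto_concave:
  assumes "continuous_on {0..1} f" "\<And>x. x \<in> {0..1} \<Longrightarrow> 0 \<le> f x" "incr_concave (\<lambda>x. x * f x)"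
  shows "L f \<longlonglongrightarrow> ln (\<beta> / \<alpha>) * integral {0..1} f"
  using renewal_density.integral_ln_tendsto[OF renewal_density_P[OF assms] ab]
  unfolding L_def[abs_def] integral_preimage[OF interval assms(1)] by (simp add: mult.commute)

lemma L_diff:
  assumes "continuous_on {0..1} f" "continuous_on {0..1} g"
  shows "L (\<lambda>x. f x - g x) n = L f n - L g n"
  unfolding L_def using integrable_on_preimage[OF interval assms(1)] integrable_on_preimage[OF interval assms(2)]
  by (simp add: integral_diff right_diff_distrib)

lemma L_tendsto_polynomial:
  assumes p: "real_polynomial_function p"
  shows "L p \<longlonglongrightarrow> ln (\<beta> / \<alpha>) * integral {0..1} p"
proof -
  define g where "g x = x * p x" for x
  have "real_polynomial_function g"
    unfolding g_def[abs_def] by (rule real_polynomial_function.intros(4)[OF real_polynomial_function.intros(1)[OF bounded_linear_ident] p])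
  then obtain g1 where g1: "real_polynomial_function g1" "\<And>x. (g has_real_derivative g1 x) (at x)"
    using has_real_derivative_polynomial_function by blast
  obtain g2 where g2: "real_polynomial_function g2" "\<And>x. (g1 has_real_derivative g2 x) (at x)"
    using has_real_derivative_polynomial_function[OF g1(1)] by blast
  have bound: "\<exists>B. \<forall>x\<in>{0..1}. \<bar>q x\<bar> \<le> B" if "real_polynomial_function q" for q :: "real \<Rightarrow> real"
  proof -
    have c: "continuous_on {0..1} q"
      using that by (intro continuous_on_polymonial_function) (simp add: real_polynomial_function_eq)
    show ?thesis
      using compact_imp_bounded[OF compact_continuous_image[OF c]] unfolding bounded_iff by auto
  qed
  obtain B0 B1 B2 where B: "\<forall>x\<in>{0..1}. \<bar>p x\<bar> \<le> B0" "\<forall>x\<in>{0..1}. \<bar>g1 x\<bar> \<le> B1" "\<forall>x\<in>{0..1}. \<bar>g2 x\<bar> \<le> B2"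
    using bound[OF p] bound[OF g1(1)] bound[OF g2(1)] by auto
  define K where "K = max B0 (max B1 B2)"
  have K: "\<bar>p x\<bar> \<le> K" "\<bar>g1 x\<bar> \<le> K" "\<bar>g2 x\<bar> \<le> K" if "x \<in> {0..1}" for x
    using B that unfolding K_def by (auto simp: le_max_iff_disj)
  have K0: "0 \<le> K" using K(1)[of 0] by auto
  have cp: "continuous_on {0..1} p"
    using p by (intro continuous_on_polymonial_function) (simp add: real_polynomial_function_eq)
  \<comment> \<open>\<open>x * k x = K * (3 * x - x^2)\<close> has derivative at least
    \<open>K\<close> on the unit interval and second derivative \<open>- 2 * K\<close>. With
    \<open>K\<close> bounding \<open>p\<close> and both derivatives of \<open>x * p x\<close>,
    adding \<open>k\<close> makes all three sign conditions hold.\<close>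
  define k where "k x = K * (3 - x)" for x
  have ck: "continuous_on {0..1} k" unfolding k_def by (intro continuous_intros)
  have k_deriv: "((\<lambda>x. x * k x) has_real_derivative K * (3 - 2 * x)) (at x)"
    "((\<lambda>x. K * (3 - 2 * x)) has_real_derivative - (2 * K)) (at x)" for x
    unfolding k_def by (auto intro!: derivative_eq_intros simp: algebra_simps)
  have Kx: "K \<le> K * (3 - 2 * x)" "K \<le> K * (3 - x)" if "x \<in> {0..1}" for x
    using that K0 mult_left_mono[of 1 "3 - 2 * x" K] mult_left_mono[of 1 "3 - x" K] by auto
  have "L (\<lambda>x. p x + k x) \<longlonglongrightarrow> ln (\<beta> / \<alpha>) * integral {0..1} (\<lambda>x. p x + k x)"
  proof (rule L_tendsto_concave)
    show "continuous_on {0..1} (\<lambda>x. p x + k x)" by (intro continuous_on_add cp ck)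
    show "0 \<le> p x + k x" if "x \<in> {0..1}" for x
      using K(1)[OF that] Kx(2)[OF that] unfolding k_def by linarith
    have "((\<lambda>x. g x + x * k x) has_real_derivative g1 x + K * (3 - 2 * x)) (at x)"
      "((\<lambda>x. g1 x + K * (3 - 2 * x)) has_real_derivative g2 x + - (2 * K)) (at x)" for x
      by (rule DERIV_add[OF g1(2) k_deriv(1)], rule DERIV_add[OF g2(2) k_deriv(2)])
    moreover have "0 \<le> g1 x + K * (3 - 2 * x)" "g2 x + - (2 * K) \<le> 0" if "x \<in> {0<..1}" for x
      using K(2,3)[of x] Kx(1)[of x] that K0 by auto
    ultimately have "incr_concave (\<lambda>x. g x + x * k x)"
      unfolding incr_concave_def
      by (intro exI[of _ "\<lambda>x. g1 x + K * (3 - 2 * x)"] exI[of _ "\<lambda>x. g2 x + - (2 * K)"]) blast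
    then show "incr_concave (\<lambda>x. x * (p x + k x))" by (simp add: g_def distrib_left)
  qed
  moreover have "L k \<longlonglongrightarrow> ln (\<beta> / \<alpha>) * integral {0..1} k"
  proof (rule L_tendsto_concave[OF ck])
    show "0 \<le> k x" if "x \<in> {0..1}" for x
      using K0 Kx(2)[OF that] unfolding k_def by linarith
    have "0 \<le> K * (3 - 2 * x)" "- (2 * K) \<le> 0" if "x \<in> {0<..1}" for x
      using Kx(1)[of x] that K0 by auto
    then show "incr_concave (\<lambda>x. x * k x)" 
      unfolding incr_concave_def using k_deriv
      by (intro exI[of _ "\<lambda>x. K * (3 - 2 * x)"] exI[of _ "\<lambda>x. - (2 * K)"]) blast
  qed
  ultimately have "(\<lambda>n. L (\<lambda>x. p x + k x) n - L k n) \<longlonglongrightarrow>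
      ln (\<beta> / \<alpha>) * integral {0..1} (\<lambda>x. p x + k x) - ln (\<beta> / \<alpha>) * integral {0..1} k"
    by (rule tendsto_diff)
  moreover have "L (\<lambda>x. p x + k x) n - L k n = L p n" for n
    using L_diff[OF continuous_on_add[OF cp ck] ck, of n] by simp
  moreover have "integral {0..1} (\<lambda>x. p x + k x) = integral {0..1} p + integral {0..1} k"
    using cp ck by (intro integral_add integrable_continuous_interval)
  ultimately show ?thesis by (simp add: distrib_left)
qed

lemma integral_approx:
  fixes f p :: "real \<Rightarrow> real"
  assumes f: "continuous_on {0..1} f" "continuous_on {0..1} p"
    and le: "\<And>x. x \<in> {0..1} \<Longrightarrow> \<bar>f x - p x\<bar> \<le> e" and S: "S \<in> sets borel" "S \<subseteq> {0..1}"
  shows "\<bar>integral S f - integral S p\<bar> \<le> e * integral S (\<lambda>_. 1)"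
proof -
  have i: "f integrable_on S" "p integrable_on S" "(\<lambda>_. 1::real) integrable_on S"
    using set_lebesgue_integral_eq_integral(1)[OF absolutely_integrable_on_unit_subset[OF _ S(2,1)]] f
    by auto
  have "norm (integral S (\<lambda>x. f x - p x)) \<le> integral S (\<lambda>_. e * 1)"
    by (rule integral_norm_bound_integral[OF integrable_diff[OF i(1,2)] integrable_on_mult_right[OF i(3)]])
      (use le S in auto)
  then show ?thesis unfolding integral_diff[OF i(1,2)] integral_mult_right real_norm_def .
qed

text \<open>Uniform approximation by polynomials suffices because \<open>ln n\<close> times the
  measure of the \<open>n\<close>-th preimage stays bounded: it is \<open>L\<close> of the constant
  polynomial 1.\<close>

theorem L_tendsto:
  assumes f: "continuous_on {0..1} f"
  shows "L f \<longlonglongrightarrow> ln (\<beta> / \<alpha>) * integral {0..1} f"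
proof (rule LIMSEQ_I)
  fix \<epsilon> :: real assume e: "0 < \<epsilon>"
  define \<Lambda> where "\<Lambda> = ln (\<beta> / \<alpha>)"
  have \<Lambda>: "0 \<le> \<Lambda>" unfolding \<Lambda>_def using ab by simp
  \<comment> \<open>\<open>\<Lambda> + 1\<close> bounds both \<open>\<Lambda>\<close> and,
    eventually, \<open>L\<close> of the constant 1, so either approximation error is at most a
    quarter of \<open>\<epsilon>\<close>.\<close>
  define e where "e = \<epsilon> / (4 * (\<Lambda> + 1))"
  have e0: "0 < e" unfolding e_def using e \<Lambda> by simp
  have e1: "e * (\<Lambda> + 1) = \<epsilon> / 4" unfolding e_def using \<Lambda> by (simp add: field_simps)
  obtain p where p: "real_polynomial_function p" and fp: "\<And>x. x \<in> {0..1} \<Longrightarrow> \<bar>f x - p x\<bar> < e"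
    using Stone_Weierstrass_real_polynomial_function[OF _ f e0] by auto
  have cp: "continuous_on {0..1} p"
    using p by (intro continuous_on_polymonial_function) (simp add: real_polynomial_function_eq)
  have le: "\<bar>f x - p x\<bar> \<le> e" if "x \<in> {0..1}" for x using fp[OF that] by simp
  have L1: "L (\<lambda>_. 1) \<longlonglongrightarrow> \<Lambda> * 1"
    using L_tendsto_polynomial[OF real_polynomial_function.intros(2)[of 1]] unfolding \<Lambda>_def by simp
  obtain n1 where n1: "\<And>n. n \<ge> n1 \<Longrightarrow> \<bar>L (\<lambda>_. 1) n - \<Lambda>\<bar> < 1"
    using LIMSEQ_D[OF L1, of 1] by auto
  obtain n2 where n2: "\<And>n. n \<ge> n2 \<Longrightarrow> \<bar>L p n - \<Lambda> * integral {0..1} p\<bar> < \<epsilon> / 4"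
    using LIMSEQ_D[OF L_tendsto_polynomial[OF p], of "\<epsilon> / 4"] e unfolding \<Lambda>_def by auto
  show "\<exists>no. \<forall>n\<ge>no. norm (L f n - ln (\<beta> / \<alpha>) * integral {0..1} f) < \<epsilon>"
  proof (intro exI allI impI)
    fix n assume n: "max 1 (max n1 n2) \<le> n"
    have "\<bar>L f n - L p n\<bar> = ln n * \<bar>integral (preimage n {\<alpha>..\<beta>}) f - integral (preimage n {\<alpha>..\<beta>}) p\<bar>"
      unfolding L_def right_diff_distrib[symmetric] abs_mult using n by simp
    also have "\<dots> \<le> ln n * (e * integral (preimage n {\<alpha>..\<beta>}) (\<lambda>_. 1))"
      using n by (intro mult_left_mono integral_approx[OF f cp le preimage_borel[OF interval] preimage_subset]) auto
    also have "\<dots> = e * L (\<lambda>_. 1) n" unfolding L_def by simp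
    also have "\<dots> \<le> e * (\<Lambda> + 1)" using n1[of n] n e0 by (intro mult_left_mono) auto
    finally have 1: "\<bar>L f n - L p n\<bar> \<le> \<epsilon> / 4" using e1 by simp
    have "\<bar>integral {0..1} f - integral {0..1} p\<bar> \<le> e"
      using integral_approx[OF f cp le, of "{0..1}"] by simp
    then have "\<Lambda> * \<bar>integral {0..1} f - integral {0..1} p\<bar> \<le> \<Lambda> * e" using \<Lambda> by (rule mult_left_mono)
    also have "\<dots> \<le> \<epsilon> / 4" using e1 e0 by (simp add: algebra_simps)
    finally have "\<bar>\<Lambda> * integral {0..1} f - \<Lambda> * integral {0..1} p\<bar> \<le> \<epsilon> / 4"
      unfolding right_diff_distrib[symmetric] abs_mult using \<Lambda> by simp
    then show "norm (L f n - ln (\<beta> / \<alpha>) * integral {0..1} f) < \<epsilon>"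
      using 1 n2[of n] n e unfolding \<Lambda>_def[symmetric] real_norm_def by linarith
  qed
qed

end

end

section \<open>The Hecke triangle groups\<close>

context
  fixes q N :: nat
  assumes q: "q = 2 * N + 1" and N: "0 < N"
begin

definition \<theta> :: real where "\<theta> = pi / real q"
definition \<sigma> :: "nat \<Rightarrow> real" where "\<sigma> i = hs q (real i)"
definition \<rho> :: "nat \<Rightarrow> real" where "\<rho> i = \<sigma> i / \<sigma> (Suc i)"

section \<open>Sine ratios as partition points\<close>

lemma \<theta>: "0 < \<theta>" "\<theta> < pi" "real q * \<theta> = pi"
proof -
  have "real q \<ge> 3" using q N by simp
  then show "0 < \<theta>" "\<theta> < pi" "real q * \<theta> = pi" unfolding \<theta>_def using pi_gt_zero
    by (auto simp: field_simps)
qed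

lemma sin_\<theta>_pos: "0 < sin \<theta>"
  using \<theta> by (intro sin_gt_zero) auto

lemma \<sigma>_eq: "\<sigma> i = sin (real i * \<theta>) / sin \<theta>"
  unfolding \<sigma>_def hs_def \<theta>_def by simp

lemma \<sigma>_pos:
  assumes "0 < i" "i < q"
  shows "0 < \<sigma> i"
proof -
  have "real i * \<theta> < real q * \<theta>" using assms \<theta>(1) by (intro mult_strict_right_mono) auto
  then have "0 < sin (real i * \<theta>)" using assms \<theta> by (intro sin_gt_zero) auto
  then show ?thesis unfolding \<sigma>_eq using sin_\<theta>_pos by simp
qed

lemma \<sigma>_0: "\<sigma> 0 = 0"
  unfolding \<sigma>_eq by simp

lemma \<sigma>_Suc_Suc: "\<sigma> (Suc (Suc i)) = 2 * cos \<theta> * \<sigma> (Suc i) - \<sigma> i"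
proof -
  define A where "A = real (Suc i) * \<theta>"
  have "real (Suc (Suc i)) * \<theta> = A + \<theta>" "real i * \<theta> = A - \<theta>" unfolding A_def by (auto simp: algebra_simps)
  then have "sin (real (Suc (Suc i)) * \<theta>) = 2 * cos \<theta> * sin A - sin (real i * \<theta>)"
    by (simp only: sin_add sin_diff) simp
  then show ?thesis unfolding \<sigma>_eq A_def[symmetric] by (simp add: diff_divide_distrib)
qed

text \<open>This is \<open>det g_k = 1\<close>; the recurrence leaves the expression unchanged. It
  yields the strict increase of \<open>\<rho>\<close>.\<close>

lemma \<sigma>_det: "\<sigma> (Suc i)^2 - \<sigma> i * \<sigma> (Suc (Suc i)) = 1"
proof (induction i)
  case 0
  then show ?case using sin_\<theta>_pos unfolding \<sigma>_eq by simp
next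
  case (Suc i)
  have "\<sigma> (Suc (Suc i))^2 - \<sigma> (Suc i) * \<sigma> (Suc (Suc (Suc i)))
    = \<sigma> (Suc i)^2 - \<sigma> i * \<sigma> (Suc (Suc i))"
    unfolding \<sigma>_Suc_Suc[of "Suc i"] \<sigma>_Suc_Suc[of i] by (simp add: power2_eq_square algebra_simps)
  then show ?case using Suc by simp
qed

lemma hs_reflect: "hs q (real q - x) = hs q x"
proof -
  have "(real q - x) * pi / real q = pi - x * pi / real q" using q by (simp add: field_simps)
  then show ?thesis unfolding hs_def by simp
qed

text \<open>Here the oddness of \<open>q\<close> enters: \<open>N\<close> and \<open>Suc N\<close>
  are exchanged by the reflection \<open>x\<close> to \<open>q - x\<close>, so the partition ends
  exactly at 1.\<close>

lemma \<sigma>_middle: "\<sigma> (Suc N) = \<sigma> N"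
proof -
  have "real q - real N = real (Suc N)" using q by simp
  then show ?thesis using hs_reflect[of "real N"] unfolding \<sigma>_def by metis
qed

lemma hecke_partition_\<rho>: "hecke_partition N \<rho> (2 * cos \<theta>)"
proof
  show "0 < N" by (rule N)
  show "\<rho> 0 = 0" unfolding \<rho>_def \<sigma>_0 by simp
  show "\<rho> N = 1" unfolding \<rho>_def \<sigma>_middle using \<sigma>_pos[of N] N q by simp
  show "2 * cos \<theta> \<le> 2" by simp
next
  fix i assume i: "i < N"
  have "Suc i < q" "Suc (Suc i) < q" using i q by simp_all
  then have p: "0 < \<sigma> (Suc i)" "0 < \<sigma> (Suc (Suc i))" using \<sigma>_pos by simp_all
  have "\<sigma> i * \<sigma> (Suc (Suc i)) < \<sigma> (Suc i) * \<sigma> (Suc i)" using \<sigma>_det[of i] by (simp add: power2_eq_square)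
  then show "\<rho> i < \<rho> (Suc i)" unfolding \<rho>_def using p by (simp add: divide_simps mult.commute)
  have "2 * cos \<theta> - \<rho> i = \<sigma> (Suc (Suc i)) / \<sigma> (Suc i)"
    unfolding \<rho>_def \<sigma>_Suc_Suc[of i] using p by (simp add: field_simps)
  then show "\<rho> (Suc i) * (2 * cos \<theta> - \<rho> i) = 1" unfolding \<rho>_def using p by simp
qed

interpretation hecke_partition N \<rho> "2 * cos \<theta>" by (rule hecke_partition_\<rho>)

text \<open>The index set is traversed downwards from \<open>q - 1\<close>, so that
  \<open>i = 0\<close> is the cell at the indifferent fixed point; the reflection symmetry of the
  sine turns the entries into consecutive \<open>\<sigma>\<close>.\<close>

lemma hg_eq:
  "hg q (int q - 1 - int i) = (\<sigma> (Suc i), - \<sigma> i, - \<sigma> (Suc (Suc i)), \<sigma> (Suc i))"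
proof -
  have "real_of_int (int q - 1 - int i) = real q - real (Suc i)"
    "real_of_int (int q - 1 - int i) + 1 = real q - real i"
    "real_of_int (int q - 1 - int i) - 1 = real q - real (Suc (Suc i))" by simp_all
  then show ?thesis unfolding hg_def \<sigma>_def by (simp only: hs_reflect)
qed

lemma mob_hg:
  assumes "i < N"
  shows "mob (hg q (int q - 1 - int i)) x = invA (\<rho> i) (\<rho> (Suc i)) x"
    "mob (mmul Qm (hg q (int q - 1 - int i))) x = invB (\<rho> i) (\<rho> (Suc i)) x"
    "0 \<le> x \<Longrightarrow> mob (minv (hg q (int q - 1 - int i))) x = brA (\<rho> i) (\<rho> (Suc i)) x"
    "0 \<le> x \<Longrightarrow> mob (minv (mmul Qm (hg q (int q - 1 - int i)))) x = brB (\<rho> i) (\<rho> (Suc i)) x"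
proof -
  define a b c where "a = \<sigma> i" and "b = \<sigma> (Suc i)" and "c = \<sigma> (Suc (Suc i))"
  have "Suc i < q" "Suc (Suc i) < q" using assms q by simp_all
  then have p: "0 < b" "0 < c" unfolding b_def c_def using \<sigma>_pos by simp_all
  note simps = hg_eq a_def[symmetric] b_def[symmetric] c_def[symmetric] \<rho>_def mob_def mmul_def minv_def Qm_def
  have frac: "b / c * (x - a / b) = (b * x - a) / c" "b / c - x = (b - c * x) / c"
    "b / c * (x + a / b) = (b * x + a) / c" "x + b / c = (c * x + b) / c"
    "b / c * (1 + a / b * x) = (b + a * x) / c" "1 + b / c * x = (c + b * x) / c"
    using p by (simp_all add: field_simps)
  show "mob (hg q (int q - 1 - int i)) x = invA (\<rho> i) (\<rho> (Suc i)) x"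
  proof -
    have "invA (a / b) (b / c) x = ((b * x - a) / c) / ((b - c * x) / c)"
      unfolding invA_def frac ..
    also have "\<dots> = (b * x - a) / (b - c * x)" using p by simp
    finally show ?thesis unfolding simps by simp
  qed
  show "mob (mmul Qm (hg q (int q - 1 - int i))) x = invB (\<rho> i) (\<rho> (Suc i)) x"
  proof -
    have "invB (a / b) (b / c) x = ((b - c * x) / c) / ((b * x - a) / c)"
      unfolding invB_def frac ..
    also have "\<dots> = (b - c * x) / (b * x - a)" using p by simp
    finally show ?thesis unfolding simps by simp
  qed
  show "mob (minv (hg q (int q - 1 - int i))) x = brA (\<rho> i) (\<rho> (Suc i)) x" if "0 \<le> x"
  proof -
    have "brA (a / b) (b / c) x = ((b * x + a) / c) / ((c * x + b) / c)"
      unfolding brA_def frac ..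
    also have "\<dots> = (b * x + a) / (c * x + b)" using p by simp
    finally show ?thesis unfolding simps by simp
  qed
  show "mob (minv (mmul Qm (hg q (int q - 1 - int i)))) x = brB (\<rho> i) (\<rho> (Suc i)) x" if "0 \<le> x"
  proof -
    have "brB (a / b) (b / c) x = ((b + a * x) / c) / ((c + b * x) / c)"
      unfolding brB_def frac ..
    also have "\<dots> = (b + a * x) / (c + b * x)" using p by simp
    \<comment> \<open>The adjugate of \<open>Q g_k\<close> has all entries nonpositive; the common
      sign cancels in the quotient.\<close>
    also have "\<dots> = (- (b + a * x)) / (- (c + b * x))" by (simp only: minus_divide_divide)
    finally show ?thesis unfolding simps by (simp add: add.commute)
  qed
qed

lemma Kset_eq: "Kset q = (\<lambda>i. int q - 1 - int i) ` {..<N}"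
proof (intro set_eqI iffI)
  fix k assume "k \<in> Kset q"
  then have "int N + 1 \<le> k" "k \<le> 2 * int N" unfolding Kset_def q by auto
  then show "k \<in> (\<lambda>i. int q - 1 - int i) ` {..<N}"
    by (intro image_eqI[of _ _ "nat (2 * int N - k)"]) (auto simp: q)
qed (auto simp: Kset_def q)

lemma farey_eq: "farey q x = (SOME y. inverse_branch_rel x y)"
  unfolding farey_def inverse_branch_rel_iff Kset_eq bex_simps(7)
  by (simp add: mob_hg Bex_def cong: conj_cong)

interpretation hecke_partition_map N \<rho> "2 * cos \<theta>" "farey q"
proof
  fix x :: real assume "x \<in> {0..1}"
  then show "inverse_branch_rel x (farey q x)"
    unfolding farey_eq by (rule someI_ex[OF inverse_branch_rel_exists])
qed

lemma farey_preimage_tendsto: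
  assumes ab: "0 < \<alpha>" "\<alpha> \<le> \<beta>" "\<beta> \<le> 1" and f: "continuous_on {0..1} f"
  shows "(\<lambda>n. ln (real n) * (LINT x:farey_preimage q n {\<alpha>..\<beta>}|lborel. f x))
           \<longlonglongrightarrow> ln (\<beta> / \<alpha>) * (LINT x:{0..1}|lborel. f x)"
proof -
  have i: "set_integrable lborel {0..1} f" by (rule borel_integrable_atLeastAtMost'[OF f])
  have "set_integrable lborel (preimage n {\<alpha>..\<beta>}) f" for n
    using preimage_borel[OF interval[OF ab]] preimage_subset by (intro set_integrable_subset[OF i]) auto
  then have "(LINT x:farey_preimage q n {\<alpha>..\<beta>}|lborel. f x) = integral (preimage n {\<alpha>..\<beta>}) f" for n
    unfolding farey_preimage_def preimage_def by (rule set_borel_integral_eq_integral(2))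
  then show ?thesis
    using L_tendsto[OF ab f] unfolding L_def[OF ab, abs_def] set_borel_integral_eq_integral(2)[OF i]
    by simp
qed

end

theorem theorem1p1:
  fixes q :: nat and \<alpha> \<beta> :: real and f :: "real \<Rightarrow> real"
  assumes "odd q" and "q \<ge> 5"
    and "0 < \<alpha>" and "\<alpha> \<le> \<beta>" and "\<beta> \<le> 1"
    and "continuous_on {0..1} f"
  shows "(\<lambda>n. ln (real n) * (LINT x:farey_preimage q n {\<alpha>..\<beta>}|lborel. f x))
           \<longlonglongrightarrow> ln (\<beta> / \<alpha>) * (LINT x:{0..1}|lborel. f x)"
proof -
  obtain N where N: "q = 2 * N + 1" using assms(1) by (elim oddE)
  then have "0 < N" using assms(2) by simp
  then show ?thesis by (rule farey_preimage_tendsto[OF N _ assms(3-6)])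
qed

end
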